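(* Let $\mathcal{A}$ be a unital $\mathbb{C}$-algebra, let $\mathcal{B}$ be a unital Banach algebra, and for each $t\in[0,1]$ let $\pi_t:\mathcal{A}\to\mathcal{B}$ be a unital algebra homomorphism such that $t\mapsto \pi_t(a)$ is continuously differentiable on $[0,1]$ (in the norm of $\mathcal B$) for every $a\in\mathcal{A}$. Let $n\ge 0$ be an integer, let $x\in C_n^{\lambda}(\mathcal{A})$, and suppose that there exists an element $y\in C_{n+2}(\mathcal{A})$ such that $b(y)=B(x)$. Then the identity $$\pi_0(x)-\pi_1(x)=(bJ)(y)$$ holds in $C_n^{\lambda,\mathrm{top}}(\mathcal{B})$.
   Context: For a unital algebra $\mathcal{A}$ over $\mathbb{C}$ and an integer $k\ge 0$, $C_k(\mathcal{A}):=\mathcal{A}^{\otimes(k+1)}$, and $C_{-1}(\mathcal A):=\{0\}$. The Hochschild boundary $b:C_k(\mathcal{A})\to C_{k-1}(\mathcal{A})$ is $$b(x_0\otimes\cdots\otimes x_k)=\sum_{i=0}^{k-1}(-1)^i x_0\otimes\cdots\otimes x_ix_{i+1}\otimes\cdots\otimes x_k+(-1)^k x_kx_0\otimes x_1\otimes\cdots\otimes x_{k-1}.$$ The cyclic operator is $t(x_0\otimes\cdots\otimes x_k)=(-1)^k x_k\otimes x_0\otimes\cdots\otimes x_{k-1}$, the norm operator is $N=1+t+\cdots+t^k$ on $C_k(\mathcal{A})$, the extra degeneracy is $s(x_0\otimes\cdots\otimes x_k)=1\otimes x_0\otimes\cdots\otimes x_k$, and the Connes boundary is $B:=(1-t)sN:C_k(\mathcal{A})\to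 C_{k+1}(\mathcal{A})$. Put $C_n^\lambda(\mathcal{A}):=C_n(\mathcal{A})/\mathrm{Im}(1-t)$; since $N(1-t)=0$, $B$ is well defined on $C_n^\lambda(\mathcal{A})$ with values in $C_{n+1}(\mathcal A)$. For the Banach algebra $\mathcal{B}$, $C_n^{\mathrm{top}}(\mathcal{B})$ denotes the $(n+1)$-fold projective tensor product $\mathcal{B}\hat\otimes\cdots\hat\otimes\mathcal{B}$, with $b$ and $t$ given by the same formulas, and $C_n^{\lambda,\mathrm{top}}(\mathcal{B}):=C_n^{\mathrm{top}}(\mathcal{B})/\mathrm{Im}(1-t)$. The homomorphism $\pi_s$ is applied to chains factor by factor. Write $a_s:=\pi_s(a)$ and $\frac{da}{dt}\big|_s$ for the derivative of $t\mapsto\pi_t(a)$ at $s$. The linear map $J:C_{m+1}(\mathcal{A})\to C_m^{\mathrm{top}}(\mathcal{B})$ ($m\geq 0$) is $$J(x^0\otimes\cdots\otimes x^{m+1})=\int_0^1 x^0_s\cdot\frac{dx^1}{dt}\Big|_s\otimes x^2_s\otimes\cdots\otimes x^{m+1}_s\,ds.$$ *)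

theory Defs
  imports "HOL-Analysis.Analysis" "HOL-Library.Poly_Mapping"
begin


class complex_vector = ab_group_add +
  fixes scaleC :: "complex \<Rightarrow> 'a \<Rightarrow> 'a"  (infixr \<open>*\<^sub>C\<close> 75)
  assumes scaleC_add_right: "c *\<^sub>C (x + y) = c *\<^sub>C x + c *\<^sub>C y"
    and scaleC_add_left: "(c + d) *\<^sub>C x = c *\<^sub>C x + d *\<^sub>C x"
    and scaleC_scaleC: "c *\<^sub>C d *\<^sub>C x = (c * d) *\<^sub>C x"
    and scaleC_one: "1 *\<^sub>C x = x"

global_interpretation cvec: vector_space "scaleC :: complex \<Rightarrow> 'a \<Rightarrow> 'a::complex_vector"
  by unfold_locales (simp_all add: scaleC_add_right scaleC_add_left scaleC_scaleC scaleC_one)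

global_interpretation cvec: vector_space_pair
  "scaleC :: complex \<Rightarrow> 'a \<Rightarrow> 'a::complex_vector" "scaleC :: complex \<Rightarrow> 'b \<Rightarrow> 'b::complex_vector"
  by unfold_locales

abbreviation clinear :: "('a::complex_vector \<Rightarrow> 'b::complex_vector) \<Rightarrow> bool" where
  "clinear \<equiv> Vector_Spaces.linear scaleC scaleC"

lemma clinearI:
  "(\<And>x y. f (x + y) = f x + f y) \<Longrightarrow> (\<And>c x. f (c *\<^sub>C x) = c *\<^sub>C f x) \<Longrightarrow> clinear f"
  by (simp add: Vector_Spaces.linear_iff cvec.vector_space_axioms)

text \<open>Both classes of algebras allow \<open>1 = 0\<close>, and \<open>norm 1\<close> need not be 1.\<close>

class complex_algebra_1 = complex_vector + ring + monoid_mult +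
  assumes mult_scaleC_left: "(c *\<^sub>C x) * y = c *\<^sub>C (x * y)"
    and mult_scaleC_right: "x * (c *\<^sub>C y) = c *\<^sub>C (x * y)"

class complex_banach_algebra_1 = complex_algebra_1 + real_normed_algebra + banach +
  assumes scaleR_scaleC: "scaleR r x = complex_of_real r *\<^sub>C x"
    and norm_scaleC: "norm (c *\<^sub>C x) = cmod c * norm x"

definition unital_hom :: "('a::complex_algebra_1 \<Rightarrow> 'b::complex_algebra_1) \<Rightarrow> bool" where
  "unital_hom f \<longleftrightarrow> clinear f \<and> f 1 = 1 \<and> (\<forall>x y. f (x * y) = f x * f y)"

instantiation poly_mapping :: (type, complex_vector) complex_vector
begin

lift_definition scaleC_poly_mapping :: "complex \<Rightarrow> ('a \<Rightarrow>\<^sub>0 'b) \<Rightarrow> 'a \<Rightarrow>\<^sub>0 'b"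
  is "\<lambda>c f x. c *\<^sub>C f x"
  by (erule rev_finite_subset) auto

instance
  by standard (transfer, simp add: fun_eq_iff scaleC_add_right scaleC_add_left scaleC_scaleC scaleC_one)+

end

instantiation complex :: complex_vector
begin

definition scaleC_complex :: "complex \<Rightarrow> complex \<Rightarrow> complex" where
  "scaleC_complex = (*)"

instance
  by standard (simp_all add: scaleC_complex_def algebra_simps)

end

lemma lookup_scaleC: "Poly_Mapping.lookup (c *\<^sub>C F) x = c *\<^sub>C Poly_Mapping.lookup F x"
  by transfer simp

inductive_set tensor_relators :: "('a::complex_vector list \<Rightarrow>\<^sub>0 complex) set" where
  add: "i < length xs \<Longrightarrow> Poly_Mapping.single (xs[i := a + b]) 1
    - (Poly_Mapping.single (xs[i := a]) 1 + Poly_Mapping.single (xs[i := b]) 1) \<in> tensor_relators"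
| scale: "i < length xs \<Longrightarrow> Poly_Mapping.single (xs[i := c *\<^sub>C a]) 1
    - c *\<^sub>C Poly_Mapping.single (xs[i := a]) 1 \<in> tensor_relators"

text \<open>
  The free complex vector space on all words over \<^typ>\<open>'a\<close>, modulo linearity in each letter.
  As the relators are homogeneous in the length of words, this is the direct sum of all tensor powers
  of \<^typ>\<open>'a\<close>, the words of length \<open>k\<close> spanning the \<open>k\<close>-th tensor power.
\<close>

quotient_type (overloaded) 'a tensor = "'a::complex_vector list \<Rightarrow>\<^sub>0 complex"
  / "\<lambda>F G. F - G \<in> cvec.span tensor_relators"
proof (rule equivpI)
  show "reflp (\<lambda>F G. F - G \<in> cvec.span (tensor_relators :: ('a list \<Rightarrow>\<^sub>0 complex) set))"
    by (rule reflpI) (simp add: cvec.span_zero)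
  show "symp (\<lambda>F G. F - G \<in> cvec.span (tensor_relators :: ('a list \<Rightarrow>\<^sub>0 complex) set))"
    by (rule sympI) (metis cvec.span_neg minus_diff_eq)
  show "transp (\<lambda>F G. F - G \<in> cvec.span (tensor_relators :: ('a list \<Rightarrow>\<^sub>0 complex) set))"
    by (rule transpI) (drule (1) cvec.span_add, simp)
qed

instantiation tensor :: (complex_vector) complex_vector
begin

lift_definition zero_tensor :: "'a tensor" is 0 .

lift_definition plus_tensor :: "'a tensor \<Rightarrow> 'a tensor \<Rightarrow> 'a tensor" is "(+)"
  by (drule (1) cvec.span_add) (simp add: algebra_simps)

lift_definition minus_tensor :: "'a tensor \<Rightarrow> 'a tensor \<Rightarrow> 'a tensor" is "(-)"
  by (drule (1) cvec.span_diff) (simp add: algebra_simps)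

lift_definition uminus_tensor :: "'a tensor \<Rightarrow> 'a tensor" is "uminus"
  by (drule cvec.span_neg) (simp add: algebra_simps)

lift_definition scaleC_tensor :: "complex \<Rightarrow> 'a tensor \<Rightarrow> 'a tensor" is "scaleC"
  by (drule cvec.span_scale) (simp add: cvec.scale_right_diff_distrib)

instance
  by standard (transfer, simp add: scaleC_add_right scaleC_add_left scaleC_scaleC scaleC_one cvec.span_zero)+

end

lift_definition pure :: "'a::complex_vector list \<Rightarrow> 'a tensor" is "\<lambda>xs. Poly_Mapping.single xs 1" .

definition multilinear :: "('a::complex_vector list \<Rightarrow> 'v::complex_vector) \<Rightarrow> bool" where
  "multilinear f \<longleftrightarrow> (\<forall>xs i a b c. i < length xs \<longrightarrow>
     f (xs[i := a + b]) = f (xs[i := a]) + f (xs[i := b]) \<and> f (xs[i := c *\<^sub>C a]) = c *\<^sub>C f (xs[i := a]))"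

definition free_lift :: "('x \<Rightarrow> 'v::complex_vector) \<Rightarrow> ('x \<Rightarrow>\<^sub>0 complex) \<Rightarrow> 'v" where
  "free_lift f F = (\<Sum>x\<in>Poly_Mapping.keys F. Poly_Mapping.lookup F x *\<^sub>C f x)"

text \<open>
  The linear map with prescribed values on words. It is independent of the representative when the
  prescription is multilinear; see \<open>tensor_lift_pure\<close> and \<open>clinear_tensor_lift\<close> below.
\<close>

definition tensor_lift :: "('a::complex_vector list \<Rightarrow> 'v::complex_vector) \<Rightarrow> 'a tensor \<Rightarrow> 'v" where
  "tensor_lift f u = free_lift f (rep_tensor u)"

lemma free_lift_superset:
  assumes "finite S" "Poly_Mapping.keys F \<subseteq> S"
  shows "free_lift f F = (\<Sum>x\<in>S. Poly_Mapping.lookup F x *\<^sub>C f x)"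
  unfolding free_lift_def
  by (rule sum.mono_neutral_left) (use assms in \<open>auto simp: in_keys_iff\<close>)

lemma clinear_free_lift: "clinear (free_lift f)"
proof (rule clinearI)
  fix F G :: "'a \<Rightarrow>\<^sub>0 complex"
  let ?S = "Poly_Mapping.keys F \<union> Poly_Mapping.keys G"
  have "free_lift f H = (\<Sum>x\<in>?S. Poly_Mapping.lookup H x *\<^sub>C f x)" if "H = F \<or> H = G \<or> H = F + G" for H
    by (rule free_lift_superset) (use that keys_add[of F G] in auto)
  then show "free_lift f (F + G) = free_lift f F + free_lift f G"
    by (simp add: lookup_add scaleC_add_left sum.distrib)
next
  fix c and F :: "'a \<Rightarrow>\<^sub>0 complex"
  have "free_lift f (c *\<^sub>C F) = (\<Sum>x\<in>Poly_Mapping.keys F. Poly_Mapping.lookup (c *\<^sub>C F) x *\<^sub>C f x)"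
    by (rule free_lift_superset) (auto simp: in_keys_iff lookup_scaleC scaleC_complex_def)
  then show "free_lift f (c *\<^sub>C F) = c *\<^sub>C free_lift f F"
    by (simp add: free_lift_def lookup_scaleC scaleC_complex_def scaleC_scaleC cvec.scale_sum_right)
qed

lemma free_lift_single [simp]: "free_lift f (Poly_Mapping.single x 1) = f x"
  by (simp add: free_lift_def scaleC_one)

lemma free_lift_relators:
  assumes "multilinear f" "F \<in> cvec.span tensor_relators"
  shows "free_lift f F = 0"
  using assms(2)
proof (induction rule: cvec.span_induct)
  case base
  show ?case
    by (rule cvec.subspaceI)
      (simp_all add: cvec.linear_0[OF clinear_free_lift] cvec.linear_add[OF clinear_free_lift] cvec.linear_scale[OF clinear_free_lift])
next
  case (step F)
  then show ?case
    using assms(1)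
    by cases (simp_all add: multilinear_def cvec.linear_diff[OF clinear_free_lift]
        cvec.linear_add[OF clinear_free_lift] cvec.linear_scale[OF clinear_free_lift])
qed

lemma tensor_lift_abs:
  assumes "multilinear f"
  shows "tensor_lift f (abs_tensor F) = free_lift f F"
proof -
  have "rep_tensor (abs_tensor F) - F \<in> cvec.span tensor_relators"
    using Quotient3_tensor by (rule rep_abs_rsp_left) (simp add: cvec.span_zero)
  then have "free_lift f (rep_tensor (abs_tensor F) - F) = 0"
    by (rule free_lift_relators[OF assms])
  then show ?thesis
    by (simp add: tensor_lift_def cvec.linear_diff[OF clinear_free_lift])
qed

lemma tensor_lift_pure: "multilinear f \<Longrightarrow> tensor_lift f (pure xs) = f xs"
  by (simp add: pure.abs_eq tensor_lift_abs)

lemma clinear_tensor_lift: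
  assumes "multilinear f"
  shows "clinear (tensor_lift f)"
proof (rule clinearI)
  show "tensor_lift f (u + v) = tensor_lift f u + tensor_lift f v" for u v
  proof (induction u; induction v)
    fix F G show "tensor_lift f (abs_tensor F + abs_tensor G) = tensor_lift f (abs_tensor F) + tensor_lift f (abs_tensor G)"
      by (simp add: plus_tensor.abs_eq tensor_lift_abs[OF assms] cvec.linear_add[OF clinear_free_lift])
  qed
  show "tensor_lift f (c *\<^sub>C u) = c *\<^sub>C tensor_lift f u" for c u
  proof (induction u)
    fix F show "tensor_lift f (c *\<^sub>C abs_tensor F) = c *\<^sub>C tensor_lift f (abs_tensor F)"
      by (simp add: scaleC_tensor.abs_eq tensor_lift_abs[OF assms] cvec.linear_scale[OF clinear_free_lift])
  qed
qed

lemma pure_update_add: "i < length xs \<Longrightarrow> pure (xs[i := a + b]) = pure (xs[i := a]) + pure (xs[i := b])"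
  by transfer (rule cvec.span_base, rule tensor_relators.add)

lemma pure_update_scaleC: "i < length xs \<Longrightarrow> pure (xs[i := c *\<^sub>C a]) = c *\<^sub>C pure (xs[i := a])"
  by transfer (rule cvec.span_base, rule tensor_relators.scale)

lemma multilinear_pure: "multilinear pure"
  by (simp add: multilinear_def pure_update_add pure_update_scaleC)

lemma clinear_abs_tensor: "clinear abs_tensor"
  by (rule clinearI) (simp_all add: plus_tensor.abs_eq scaleC_tensor.abs_eq)

lemma free_vector_expand: "F = free_lift (\<lambda>x. Poly_Mapping.single x 1) F" for F :: "'x \<Rightarrow>\<^sub>0 complex"
proof (rule poly_mapping_eqI)
  fix k
  have "Poly_Mapping.lookup (free_lift (\<lambda>x. Poly_Mapping.single x 1) F) k
    = (\<Sum>x\<in>Poly_Mapping.keys F. if x = k then Poly_Mapping.lookup F k else 0)"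
    unfolding free_lift_def lookup_sum
    by (rule sum.cong) (auto simp: lookup_scaleC scaleC_complex_def lookup_single)
  then show "Poly_Mapping.lookup F k = Poly_Mapping.lookup (free_lift (\<lambda>x. Poly_Mapping.single x 1) F) k"
    by (simp add: in_keys_iff)
qed

lemma abs_tensor_eq: "abs_tensor F = free_lift pure F"
  by (subst free_vector_expand)
    (simp add: free_lift_def cvec.linear_sum[OF clinear_abs_tensor] cvec.linear_scale[OF clinear_abs_tensor] pure.abs_eq)

lemma tensor_expand: "\<exists>F. u = free_lift pure F"
  by (induction u) (metis abs_tensor_eq)


text \<open>Degree \<open>k\<close> chains are tensors with \<open>k + 1\<close> factors.\<close>

definition hochschild_chains :: "nat \<Rightarrow> 'a::complex_vector tensor set" where
  "hochschild_chains k = cvec.span {pure xs |xs. length xs = Suc k}"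

text \<open>In degree \<open>0\<close> the boundary is zero by convention, not the term \<open>x * x\<close> that the general formula would give.\<close>

definition boundary_word :: "'a::complex_algebra_1 list \<Rightarrow> 'a tensor" where
  "boundary_word xs = (let k = length xs - 1 in
     if k = 0 then 0
     else (\<Sum>i<k. (-1) ^ i *\<^sub>C pure (take i xs @ (xs ! i * xs ! (i + 1)) # drop (i + 2) xs))
       + (-1) ^ k *\<^sub>C pure ((xs ! k * xs ! 0) # take (k - 1) (drop 1 xs)))"

definition boundary :: "'a::complex_algebra_1 tensor \<Rightarrow> 'a tensor" where
  "boundary = tensor_lift boundary_word"

definition cyc :: "'a::complex_vector tensor \<Rightarrow> 'a tensor" where
  "cyc = tensor_lift (\<lambda>xs. (-1) ^ (length xs - 1) *\<^sub>C pure (last xs # butlast xs))"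

text \<open>The number of summands of \<open>N\<close> depends on the degree \<open>k\<close>, which is therefore an argument.\<close>

definition norm_op :: "nat \<Rightarrow> 'a::complex_vector tensor \<Rightarrow> 'a tensor" where
  "norm_op k u = (\<Sum>j\<le>k. (cyc ^^ j) u)"

definition degen :: "'a::complex_algebra_1 tensor \<Rightarrow> 'a tensor" where
  "degen = tensor_lift (\<lambda>xs. pure (1 # xs))"

definition connes :: "nat \<Rightarrow> 'a::complex_algebra_1 tensor \<Rightarrow> 'a tensor" where
  "connes k u = degen (norm_op k u) - cyc (degen (norm_op k u))"

lemma pure_in_chains: "length xs = Suc k \<Longrightarrow> pure xs \<in> hochschild_chains k"
  unfolding hochschild_chains_def by (rule cvec.span_base) auto

lemma multilinear_scale: "multilinear f \<Longrightarrow> multilinear (\<lambda>xs. g (length xs) *\<^sub>C f xs)"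
  by (simp add: multilinear_def scaleC_add_right scaleC_scaleC mult.commute)

lemma multilinear_add: "multilinear f \<Longrightarrow> multilinear g \<Longrightarrow> multilinear (\<lambda>xs. f xs + g xs)"
  by (simp add: multilinear_def scaleC_add_right algebra_simps)

lemma multilinear_sum:
  "(\<And>i. multilinear (f i)) \<Longrightarrow> multilinear (\<lambda>xs. \<Sum>i<g (length xs). f i xs)"
  by (simp add: multilinear_def cvec.scale_sum_right sum.distrib)

lemma multilinear_if:
  "multilinear f \<Longrightarrow> multilinear g \<Longrightarrow> multilinear (\<lambda>xs. if P (length xs) then f xs else g xs)"
  by (simp add: multilinear_def)

lemma multilinear_0: "multilinear (\<lambda>xs. 0)"
  by (simp add: multilinear_def)

lemma pure_Cons_add: "pure ((a + b) # xs) = pure (a # xs) + pure (b # xs)"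
  using pure_update_add[of 0 "a # xs" a b] by simp

lemma pure_Cons_scaleC: "pure ((c *\<^sub>C a) # xs) = c *\<^sub>C pure (a # xs)"
  using pure_update_scaleC[of 0 "a # xs" c a] by simp

lemma pure_mid_add: "pure (ys @ (a + b) # xs) = pure (ys @ a # xs) + pure (ys @ b # xs)"
  using pure_update_add[of "length ys" "ys @ a # xs" a b] by simp

lemma pure_mid_scaleC: "pure (ys @ (c *\<^sub>C a) # xs) = c *\<^sub>C pure (ys @ a # xs)"
  using pure_update_scaleC[of "length ys" "ys @ a # xs" c a] by simp

lemma multilinear_context:
  fixes f :: "'a::complex_vector list \<Rightarrow> 'v::complex_vector"
  assumes "\<And>xs i. i < length xs \<Longrightarrow> \<exists>g. clinear g \<and> (\<forall>a. f (xs[i := a]) = g a)"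
  shows "multilinear f"
  unfolding multilinear_def
proof (intro allI impI)
  fix xs :: "'a list" and i a b c
  assume "i < length xs"
  then obtain g where "clinear g" "\<forall>a. f (xs[i := a]) = g a"
    using assms by blast
  then show "f (xs[i := a + b]) = f (xs[i := a]) + f (xs[i := b]) \<and> f (xs[i := c *\<^sub>C a]) = c *\<^sub>C f (xs[i := a])"
    by (simp add: cvec.linear_add cvec.linear_scale)
qed

lemma contextI: "clinear g \<Longrightarrow> (\<And>a. f a = g a) \<Longrightarrow> \<exists>g. clinear g \<and> (\<forall>a. f a = g a)"
  by blast

lemma clinear_pure_mid:
  assumes "clinear g"
  shows "clinear (\<lambda>a. pure (ys @ g a # xs))"
  by (rule clinearI) (simp_all add: cvec.linear_add[OF assms] cvec.linear_scale[OF assms] pure_mid_add pure_mid_scaleC)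

lemma clinear_mult_left: "clinear (\<lambda>a. a * b)" for b :: "'a::complex_algebra_1"
  by (rule clinearI) (simp_all add: distrib_right mult_scaleC_left)

lemma clinear_mult_right: "clinear (\<lambda>a. b * a)" for b :: "'a::complex_algebra_1"
  by (rule clinearI) (simp_all add: distrib_left mult_scaleC_right)

lemma clinear_ident: "clinear (\<lambda>a. a)"
  by (rule clinearI) simp_all

lemma multilinear_cyc_word:
  "multilinear (\<lambda>xs. (-1) ^ (length xs - 1) *\<^sub>C pure (last xs # butlast xs))"
proof (rule multilinear_scale[where g = "\<lambda>n. (-1) ^ (n - 1)"], rule multilinear_context)
  fix xs :: "'a list" and i
  assume i: "i < length xs"
  show "\<exists>g. clinear g \<and> (\<forall>a. pure (last (xs[i := a]) # butlast (xs[i := a])) = g a)"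
  proof (cases xs rule: rev_cases)
    case (snoc ys y)
    show ?thesis
    proof (cases "i = length ys")
      case True
      then show ?thesis
        using snoc clinear_pure_mid[OF clinear_ident, of "[]" ys] by (intro contextI) (simp_all add: list_update_append)
    next
      case False
      then have "i < length ys" using i snoc by simp
      then have "pure (last (xs[i := a]) # butlast (xs[i := a])) = pure ((y # take i ys) @ a # drop (Suc i) ys)" for a
        using snoc by (simp add: list_update_append butlast_append upd_conv_take_nth_drop)
      from contextI[OF clinear_pure_mid[OF clinear_ident] this] show ?thesis .
    qed
  qed (use i in simp)
qed

lemma clinear_cyc: "clinear cyc"
  unfolding cyc_def by (rule clinear_tensor_lift[OF multilinear_cyc_word])

lemma cyc_pure: "cyc (pure xs) = (-1) ^ (length xs - 1) *\<^sub>C pure (last xs # butlast xs)"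
  unfolding cyc_def by (rule tensor_lift_pure[OF multilinear_cyc_word])

lemma multilinear_degen_word: "multilinear (\<lambda>xs. pure (1 # xs))"
proof (rule multilinear_context)
  fix xs :: "'a list" and i
  assume "i < length xs"
  then have "pure (1 # xs[i := a]) = pure ((1 # take i xs) @ a # drop (Suc i) xs)" for a
    by (simp add: upd_conv_take_nth_drop)
  from contextI[OF clinear_pure_mid[OF clinear_ident] this] show "\<exists>g. clinear g \<and> (\<forall>a. pure (1 # xs[i := a]) = g a)" .
qed

lemma clinear_degen: "clinear degen"
  unfolding degen_def by (rule clinear_tensor_lift[OF multilinear_degen_word])

lemma degen_pure: "degen (pure xs) = pure (1 # xs)"
  unfolding degen_def by (rule tensor_lift_pure[OF multilinear_degen_word])

lemma multilinear_merge_word: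
  "multilinear (\<lambda>xs :: 'a::complex_algebra_1 list. if Suc i < length xs
     then pure (take i xs @ (xs ! i * xs ! (i + 1)) # drop (i + 2) xs) else 0)"
  (is "multilinear ?f")
proof (rule multilinear_context)
  fix xs :: "'a list" and j
  assume j: "j < length xs"
  show "\<exists>g. clinear g \<and> (\<forall>a. ?f (xs[j := a]) = g a)"
  proof (cases "Suc i < length xs")
    case True
    consider "j < i" | "j = i" | "j = Suc i" | "Suc i < j" by linarith
    then show ?thesis
    proof cases
      case 1
      then have "take i (xs[j := a]) = take j xs @ a # drop (Suc j) (take i xs)" for a
        using j True upd_conv_take_nth_drop[of j "take i xs" a] by (simp add: take_update_swap min_def)
      with 1 have "?f (xs[j := a]) = pure (take j xs @ a # drop (Suc j) (take i xs) @ (xs ! i * xs ! (i + 1)) # drop (i + 2) xs)" for a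
        using True j by simp
      from contextI[OF clinear_pure_mid[OF clinear_ident] this] show ?thesis .
    next
      case 2
      then have "?f (xs[j := a]) = pure (take i xs @ (a * xs ! (i + 1)) # drop (i + 2) xs)" for a
        using True by simp
      from contextI[OF clinear_pure_mid[OF clinear_mult_left] this] show ?thesis .
    next
      case 3
      then have "?f (xs[j := a]) = pure (take i xs @ (xs ! i * a) # drop (i + 2) xs)" for a
        using True by simp
      from contextI[OF clinear_pure_mid[OF clinear_mult_right] this] show ?thesis .
    next
      case 4
      let ?w = "drop (i + 2) xs"
      have "?f (xs[j := a]) = pure ((take i xs @ (xs ! i * xs ! (i + 1)) # take (j - (i + 2)) ?w) @ a # drop (Suc (j - (i + 2))) ?w)" for a
        using True 4 j upd_conv_take_nth_drop[of "j - (i + 2)" ?w a] by (simp add: drop_update_swap)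
      from contextI[OF clinear_pure_mid[OF clinear_ident] this] show ?thesis .
    qed
  next
    case False
    then show ?thesis
      by (intro exI[of _ "\<lambda>a. 0"]) (auto intro: clinearI)
  qed
qed

lemma multilinear_wrap_word:
  "multilinear (\<lambda>xs :: 'a::complex_algebra_1 list. if Suc 0 < length xs
     then pure ((xs ! (length xs - 1) * xs ! 0) # take (length xs - 1 - 1) (drop 1 xs)) else 0)"
  (is "multilinear ?f")
proof (rule multilinear_context)
  fix xs :: "'a list" and j
  assume j: "j < length xs"
  show "\<exists>g. clinear g \<and> (\<forall>a. ?f (xs[j := a]) = g a)"
  proof (cases "Suc 0 < length xs")
    case True
    let ?k = "length xs - 1"
    consider "j = 0" | "j = ?k" "j \<noteq> 0" | "0 < j" "j < ?k" using j by linarith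
    then show ?thesis
    proof cases
      case 1
      then have "?f (xs[j := a]) = pure ([] @ (xs ! ?k * a) # take (?k - 1) (drop 1 xs))" for a
        using True j by simp
      from contextI[OF clinear_pure_mid[OF clinear_mult_right] this] show ?thesis .
    next
      case 2
      then have "?f (xs[j := a]) = pure ([] @ (a * xs ! 0) # take (?k - 1) (drop 1 xs))" for a
        using True by (simp add: drop_update_swap take_update_cancel)
      from contextI[OF clinear_pure_mid[OF clinear_mult_left] this] show ?thesis .
    next
      case 3
      let ?w = "take (?k - 1) (drop 1 xs)"
      have "?f (xs[j := a]) = pure (((xs ! ?k * xs ! 0) # take (j - 1) ?w) @ a # drop (Suc (j - 1)) ?w)" for a
        using True 3 upd_conv_take_nth_drop[of "j - 1" ?w a] by (simp add: drop_update_swap take_update_swap)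
      from contextI[OF clinear_pure_mid[OF clinear_ident] this] show ?thesis .
    qed
  next
    case False
    then show ?thesis
      by (intro exI[of _ "\<lambda>a. 0"]) (auto intro: clinearI)
  qed
qed

lemma multilinear_boundary_word: "multilinear boundary_word"
proof -
  have *: "boundary_word = (\<lambda>xs :: 'a list. (\<Sum>i<length xs - 1. (-1) ^ i *\<^sub>C
      (if Suc i < length xs then pure (take i xs @ (xs ! i * xs ! (i + 1)) # drop (i + 2) xs) else 0))
    + (-1) ^ (length xs - 1) *\<^sub>C
      (if Suc 0 < length xs then pure ((xs ! (length xs - 1) * xs ! 0) # take (length xs - 1 - 1) (drop 1 xs)) else 0))"
    by (rule ext) (auto simp: boundary_word_def Let_def intro!: arg_cong2[of _ _ _ _ "(+)"] sum.cong)
  show ?thesis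
    unfolding *
    by (rule multilinear_add[OF multilinear_sum[where g = "\<lambda>n. n - 1",
          OF multilinear_scale[where g = "\<lambda>n. (-1) ^ i" for i, OF multilinear_merge_word]]
        multilinear_scale[where g = "\<lambda>n. (-1) ^ (n - 1)", OF multilinear_wrap_word]])
qed

lemma clinear_boundary: "clinear boundary"
  unfolding boundary_def by (rule clinear_tensor_lift[OF multilinear_boundary_word])

lemma boundary_pure: "boundary (pure xs) = boundary_word xs"
  unfolding boundary_def by (rule tensor_lift_pure[OF multilinear_boundary_word])

lemma clinear_cyc_pow: "clinear (cyc ^^ j)"
proof (induction j)
  case (Suc j)
  then show ?case
    by (intro clinearI) (simp_all add: cvec.linear_add[OF clinear_cyc] cvec.linear_scale[OF clinear_cyc]
        cvec.linear_add cvec.linear_scale)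
qed (simp add: clinearI)

lemma cyc_pow_pure:
  "j \<le> Suc k \<Longrightarrow> length xs = Suc k \<Longrightarrow>
    (cyc ^^ j) (pure xs) = (-1) ^ (k * j) *\<^sub>C pure (drop (Suc k - j) xs @ take (Suc k - j) xs)"
proof (induction j)
  case (Suc j)
  let ?w = "drop (Suc k - j) xs @ take (Suc k - j) xs"
  have j: "Suc k - j = Suc (k - j)" "k - j < length xs"
    using Suc.prems by auto
  have t: "take (Suc k - j) xs = take (k - j) xs @ [xs ! (k - j)]"
    unfolding j(1) by (rule take_Suc_conv_app_nth[OF j(2)])
  have d: "drop (k - j) xs = xs ! (k - j) # drop (Suc k - j) xs"
    unfolding j(1) by (rule Cons_nth_drop_Suc[OF j(2), symmetric])
  have w: "last ?w # butlast ?w = drop (Suc k - Suc j) xs @ take (Suc k - Suc j) xs"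
    by (simp add: t d butlast_append)
  have "length ?w - 1 = k"
    using Suc.prems by simp
  then have "cyc (pure ?w) = (-1) ^ k *\<^sub>C pure (drop (Suc k - Suc j) xs @ take (Suc k - Suc j) xs)"
    using cyc_pure[of ?w] unfolding w by simp
  then show ?case
    using Suc.IH Suc.prems
    by (simp add: cvec.linear_scale[OF clinear_cyc] scaleC_scaleC power_add mult.commute del: diff_Suc_Suc)
qed (simp add: scaleC_one)

lemma cyc_pow_chains:
  assumes "u \<in> hochschild_chains k"
  shows "(cyc ^^ Suc k) u = u"
  using assms unfolding hochschild_chains_def
proof (induction rule: cvec.span_induct)
  case base
  show ?case
    by (rule cvec.subspaceI)
      (simp_all only: mem_Collect_eq cvec.linear_0[OF clinear_cyc_pow] cvec.linear_add[OF clinear_cyc_pow]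
        cvec.linear_scale[OF clinear_cyc_pow])
next
  case (step u)
  then obtain xs where xs: "u = pure xs" "length xs = Suc k"
    by blast
  have "even (k * Suc k)"
    by simp
  then have "(-1 :: complex) ^ (k * Suc k) = 1"
    by (rule neg_one_even_power)
  then show ?case
    using cyc_pow_pure[OF order_refl xs(2)] xs(1) by (simp only: scaleC_one) simp
qed

lemma norm_op_cyc:
  assumes "u \<in> hochschild_chains k"
  shows "norm_op k (cyc u) = norm_op k u"
proof -
  have "norm_op k (cyc u) = (\<Sum>j\<le>k. (cyc ^^ Suc j) u)"
    unfolding norm_op_def funpow_Suc_right comp_def ..
  also have "\<dots> = norm_op k u"
    using sum.atMost_Suc_shift[of "\<lambda>j. (cyc ^^ j) u" k] unfolding sum.atMost_Suc cyc_pow_chains[OF assms]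
    by (simp only: norm_op_def funpow_0) simp
  finally show ?thesis .
qed



class complex_seminormed = complex_vector +
  fixes seminorm :: "'a \<Rightarrow> real"
  assumes seminorm_triangle: "seminorm (x + y) \<le> seminorm x + seminorm y"
    and seminorm_scaleC: "seminorm (c *\<^sub>C x) = cmod c * seminorm x"

lemma seminorm_zero [simp]: "seminorm 0 = 0"
  using seminorm_scaleC[of 0 0] by simp

lemma seminorm_minus: "seminorm (- x) = seminorm x"
  using seminorm_scaleC[of "-1" x] by (simp add: scaleC_one)

lemma seminorm_minus_commute: "seminorm (x - y) = seminorm (y - x)"
  using seminorm_minus[of "x - y"] by simp

lemma seminorm_nonneg: "0 \<le> seminorm x"
  using seminorm_triangle[of x "- x"] by (simp add: seminorm_minus)

lemma seminorm_triangle_sub: "seminorm (x - y) \<le> seminorm x + seminorm y"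
  using seminorm_triangle[of x "- y"] by (simp add: seminorm_minus)

lemma seminorm_triangle3: "seminorm (x - z) \<le> seminorm (x - y) + seminorm (y - z)"
  using seminorm_triangle[of "x - y" "y - z"] by simp

lemma seminorm_diff_le: "\<bar>seminorm x - seminorm y\<bar> \<le> seminorm (x - y)"
  using seminorm_triangle[of "x - y" y] seminorm_triangle[of "y - x" x] seminorm_minus_commute[of x y]
  by simp

lemma seminorm_add_diff: "seminorm ((a + b) - (c + d)) \<le> seminorm (a - c) + seminorm (b - d)"
  using seminorm_triangle[of "a - c" "b - d"] by (simp add: algebra_simps)

lemma seminorm_diff_diff: "seminorm ((a - b) - (c - d)) \<le> seminorm (a - c) + seminorm (b - d)"
  using seminorm_triangle_sub[of "a - c" "b - d"] by (simp add: algebra_simps)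

lemma seminorm_sum_le: "seminorm (\<Sum>i\<in>A. f i) \<le> (\<Sum>i\<in>A. seminorm (f i))"
proof (induction A rule: infinite_finite_induct)
  case (insert x A)
  then show ?case
    using seminorm_triangle[of "f x" "\<Sum>i\<in>A. f i"] by simp
qed simp_all

definition seminorm_Cauchy :: "(nat \<Rightarrow> 'v::complex_seminormed) \<Rightarrow> bool" where
  "seminorm_Cauchy X \<longleftrightarrow> (\<forall>e>0. \<exists>M. \<forall>m\<ge>M. \<forall>n\<ge>M. seminorm (X m - X n) < e)"

definition completion_rel :: "(nat \<Rightarrow> 'v::complex_seminormed) \<Rightarrow> (nat \<Rightarrow> 'v) \<Rightarrow> bool" where
  "completion_rel X Y \<longleftrightarrow> seminorm_Cauchy X \<and> seminorm_Cauchy Y \<and> (\<lambda>n. seminorm (X n - Y n)) \<longlonglongrightarrow> 0"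

lemma seminorm_Cauchy_const [simp]: "seminorm_Cauchy (\<lambda>n. x)"
  by (simp add: seminorm_Cauchy_def)

lemma seminorm_Cauchy_lipschitz2:
  assumes "seminorm_Cauchy X" "seminorm_Cauchy Y"
    and "\<And>m n. seminorm (Z m - Z n) \<le> seminorm (X m - X n) + seminorm (Y m - Y n)"
  shows "seminorm_Cauchy Z"
  unfolding seminorm_Cauchy_def
proof (intro allI impI)
  fix e :: real
  assume "e > 0"
  then have "e / 2 > 0" by simp
  then obtain M N where M: "\<forall>m\<ge>M. \<forall>n\<ge>M. seminorm (X m - X n) < e / 2"
    and N: "\<forall>m\<ge>N. \<forall>n\<ge>N. seminorm (Y m - Y n) < e / 2"
    using assms(1,2) unfolding seminorm_Cauchy_def by meson
  have "seminorm (Z m - Z n) < e" if "m \<ge> max M N" "n \<ge> max M N" for m n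
    using M[rule_format, of m n] N[rule_format, of m n] that assms(3)[of m n] by simp
  then show "\<exists>M. \<forall>m\<ge>M. \<forall>n\<ge>M. seminorm (Z m - Z n) < e" by blast
qed

lemma seminorm_Cauchy_lipschitz:
  assumes "seminorm_Cauchy X" and "\<And>m n. seminorm (Z m - Z n) \<le> K * seminorm (X m - X n)"
  shows "seminorm_Cauchy Z"
  unfolding seminorm_Cauchy_def
proof (intro allI impI)
  fix e :: real
  assume "e > 0"
  then have "e / (\<bar>K\<bar> + 1) > 0" by simp
  then obtain M where M: "\<forall>m\<ge>M. \<forall>n\<ge>M. seminorm (X m - X n) < e / (\<bar>K\<bar> + 1)"
    using assms(1) unfolding seminorm_Cauchy_def by meson
  have "seminorm (Z m - Z n) < e" if "m \<ge> M" "n \<ge> M" for m n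
  proof -
    have "seminorm (Z m - Z n) \<le> (\<bar>K\<bar> + 1) * seminorm (X m - X n)"
      using assms(2)[of m n] mult_right_mono[of K "\<bar>K\<bar> + 1", OF _ seminorm_nonneg[of "X m - X n"]] by linarith
    also have "\<dots> < e"
      using M that by (simp add: field_simps)
    finally show ?thesis .
  qed
  then show "\<exists>M. \<forall>m\<ge>M. \<forall>n\<ge>M. seminorm (Z m - Z n) < e" by blast
qed

lemma seminorm_Cauchy_add: "seminorm_Cauchy X \<Longrightarrow> seminorm_Cauchy Y \<Longrightarrow> seminorm_Cauchy (\<lambda>n. X n + Y n)"
  by (erule (1) seminorm_Cauchy_lipschitz2) (rule seminorm_add_diff)

lemma seminorm_Cauchy_diff: "seminorm_Cauchy X \<Longrightarrow> seminorm_Cauchy Y \<Longrightarrow> seminorm_Cauchy (\<lambda>n. X n - Y n)"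
  by (erule (1) seminorm_Cauchy_lipschitz2) (rule seminorm_diff_diff)

lemma seminorm_Cauchy_scaleC: "seminorm_Cauchy X \<Longrightarrow> seminorm_Cauchy (\<lambda>n. c *\<^sub>C X n)"
  by (erule seminorm_Cauchy_lipschitz[where K = "cmod c"])
    (simp add: seminorm_scaleC flip: cvec.scale_right_diff_distrib)

lemma seminorm_Cauchy_minus: "seminorm_Cauchy X \<Longrightarrow> seminorm_Cauchy (\<lambda>n. - X n)"
  using seminorm_Cauchy_diff[OF seminorm_Cauchy_const[of 0]] by simp

lemma seminorm_null_squeeze: "(\<And>n. seminorm (X n) \<le> f n) \<Longrightarrow> f \<longlonglongrightarrow> 0 \<Longrightarrow> (\<lambda>n. seminorm (X n)) \<longlonglongrightarrow> 0"
  by (rule tendsto_sandwich[where f = "\<lambda>n. 0" and h = f]) (auto simp: seminorm_nonneg)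

text \<open>
  The Hausdorff completion: Cauchy sequences modulo null sequences.
\<close>

quotient_type (overloaded) 'v completion = "nat \<Rightarrow> 'v::complex_seminormed" / partial: completion_rel
proof (rule part_equivpI)
  show "\<exists>X :: nat \<Rightarrow> 'v. completion_rel X X"
    by (rule exI[of _ "\<lambda>n. 0"]) (simp add: completion_rel_def)
  show "symp (completion_rel :: (nat \<Rightarrow> 'v) \<Rightarrow> _)"
    by (rule sympI) (simp add: completion_rel_def seminorm_minus_commute)
  show "transp (completion_rel :: (nat \<Rightarrow> 'v) \<Rightarrow> _)"
  proof (rule transpI)
    fix X Y Z :: "nat \<Rightarrow> 'v"
    assume *: "completion_rel X Y" "completion_rel Y Z"
    then have "(\<lambda>n. seminorm (X n - Y n) + seminorm (Y n - Z n)) \<longlonglongrightarrow> 0"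
      using tendsto_add[of "\<lambda>n. seminorm (X n - Y n)" 0 _ "\<lambda>n. seminorm (Y n - Z n)" 0]
      by (simp add: completion_rel_def)
    then have "(\<lambda>n. seminorm (X n - Z n)) \<longlonglongrightarrow> 0"
      by (rule seminorm_null_squeeze[OF seminorm_triangle3])
    with * show "completion_rel X Z"
      by (simp add: completion_rel_def)
  qed
qed

lemma completion_rel_refl: "completion_rel X X \<longleftrightarrow> seminorm_Cauchy X"
  by (auto simp: completion_rel_def)

lemma completion_rel_lipschitz2:
  assumes "completion_rel X X'" "completion_rel Y Y'" "seminorm_Cauchy Z" "seminorm_Cauchy Z'"
    and "\<And>n. seminorm (Z n - Z' n) \<le> seminorm (X n - X' n) + seminorm (Y n - Y' n)"
  shows "completion_rel Z Z'"
  unfolding completion_rel_def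
proof (intro conjI seminorm_null_squeeze[OF assms(5)])
  show "(\<lambda>n. seminorm (X n - X' n) + seminorm (Y n - Y' n)) \<longlonglongrightarrow> 0"
    using assms(1,2) tendsto_add[of "\<lambda>n. seminorm (X n - X' n)" 0 _ "\<lambda>n. seminorm (Y n - Y' n)" 0]
    by (simp add: completion_rel_def)
qed (rule assms)+

lemma seminorm_convergent: "seminorm_Cauchy X \<Longrightarrow> convergent (\<lambda>n. seminorm (X n))"
proof -
  assume X: "seminorm_Cauchy X"
  have "Cauchy (\<lambda>n. seminorm (X n))"
  proof (rule CauchyI)
    fix e :: real assume "e > 0"
    then obtain M where "\<forall>m\<ge>M. \<forall>n\<ge>M. seminorm (X m - X n) < e"
      using X unfolding seminorm_Cauchy_def by blast
    then have "\<forall>m\<ge>M. \<forall>n\<ge>M. norm (seminorm (X m) - seminorm (X n)) < e"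
      unfolding real_norm_def by (meson order_le_less_trans seminorm_diff_le)
    then show "\<exists>M. \<forall>m\<ge>M. \<forall>n\<ge>M. norm (seminorm (X m) - seminorm (X n)) < e" ..
  qed
  then show ?thesis by (rule Cauchy_convergent)
qed

instantiation completion :: (complex_seminormed) complex_vector
begin

lift_definition zero_completion :: "'a completion" is "\<lambda>n. 0"
  by (simp add: completion_rel_refl)

lift_definition plus_completion :: "'a completion \<Rightarrow> 'a completion \<Rightarrow> 'a completion" is "\<lambda>X Y n. X n + Y n"
  by (rule completion_rel_lipschitz2, assumption, assumption)
    (auto simp: completion_rel_def intro: seminorm_Cauchy_add seminorm_add_diff)

lift_definition minus_completion :: "'a completion \<Rightarrow> 'a completion \<Rightarrow> 'a completion" is "\<lambda>X Y n. X n - Y n"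
  by (rule completion_rel_lipschitz2, assumption, assumption)
    (auto simp: completion_rel_def intro: seminorm_Cauchy_diff seminorm_diff_diff)

lift_definition uminus_completion :: "'a completion \<Rightarrow> 'a completion" is "\<lambda>X n. - X n"
  unfolding completion_rel_def
  by (simp add: seminorm_Cauchy_minus) (simp add: seminorm_minus_commute)

lift_definition scaleC_completion :: "complex \<Rightarrow> 'a completion \<Rightarrow> 'a completion" is "\<lambda>c X n. c *\<^sub>C X n"
  unfolding completion_rel_def
  by (simp add: seminorm_Cauchy_scaleC seminorm_scaleC tendsto_mult_right_zero flip: cvec.scale_right_diff_distrib)

instance
proof
  fix a b c :: "'a completion" and z w :: complex
  show "a + b + c = a + (b + c)"
    by transfer (simp add: completion_rel_refl add.assoc seminorm_Cauchy_add)
  show "a + b = b + a"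
    by transfer (simp add: completion_rel_def add.commute seminorm_Cauchy_add)
  show "0 + a = a"
    by transfer (simp add: completion_rel_refl)
  show "- a + a = 0"
    by transfer (simp add: completion_rel_refl)
  show "a - b = a + - b"
    by transfer (simp add: completion_rel_refl seminorm_Cauchy_diff)
  show "z *\<^sub>C (a + b) = z *\<^sub>C a + z *\<^sub>C b"
    by transfer (simp add: completion_rel_refl scaleC_add_right seminorm_Cauchy_add seminorm_Cauchy_scaleC)
  show "(z + w) *\<^sub>C a = z *\<^sub>C a + w *\<^sub>C a"
    by transfer (simp add: completion_rel_refl scaleC_add_left seminorm_Cauchy_add seminorm_Cauchy_scaleC)
  show "z *\<^sub>C w *\<^sub>C a = (z * w) *\<^sub>C a"
    by transfer (simp add: completion_rel_refl scaleC_scaleC seminorm_Cauchy_scaleC)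
  show "1 *\<^sub>C a = a"
    by transfer (simp add: completion_rel_refl scaleC_one)
qed

end

instantiation completion :: (complex_seminormed) real_normed_vector
begin

definition scaleR_completion :: "real \<Rightarrow> 'a completion \<Rightarrow> 'a completion" where
  "scaleR_completion r u = complex_of_real r *\<^sub>C u"

lift_definition norm_completion :: "'a completion \<Rightarrow> real" is "\<lambda>X. lim (\<lambda>n. seminorm (X n))"
proof -
  fix X Y :: "nat \<Rightarrow> 'a"
  assume "completion_rel X Y"
  then have X: "seminorm_Cauchy X" and Y: "seminorm_Cauchy Y" and XY: "(\<lambda>n. seminorm (X n - Y n)) \<longlonglongrightarrow> 0"
    by (simp_all add: completion_rel_def)
  have "(\<lambda>n. seminorm (X n) - seminorm (Y n)) \<longlonglongrightarrow> 0"
    by (rule tendsto_rabs_zero_cancel)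
      (rule tendsto_sandwich[OF _ _ tendsto_const XY], auto simp: seminorm_diff_le)
  moreover have "(\<lambda>n. seminorm (X n) - seminorm (Y n)) \<longlonglongrightarrow> lim (\<lambda>n. seminorm (X n)) - lim (\<lambda>n. seminorm (Y n))"
    by (intro tendsto_diff seminorm_convergent[THEN convergent_LIMSEQ_iff[THEN iffD1]] X Y)
  ultimately show "lim (\<lambda>n. seminorm (X n)) = lim (\<lambda>n. seminorm (Y n))"
    using LIMSEQ_unique by fastforce
qed

definition sgn_completion :: "'a completion \<Rightarrow> 'a completion" where
  "sgn_completion u = scaleR (inverse (norm u)) u"

definition dist_completion :: "'a completion \<Rightarrow> 'a completion \<Rightarrow> real" where
  "dist_completion u v = norm (u - v)"

definition uniformity_completion :: "('a completion \<times> 'a completion) filter" where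
  "uniformity_completion = (INF e\<in>{0<..}. principal {(u, v). dist u v < e})"

definition open_completion :: "'a completion set \<Rightarrow> bool" where
  "open_completion U \<longleftrightarrow> (\<forall>u\<in>U. \<forall>\<^sub>F (v, w) in uniformity. v = u \<longrightarrow> w \<in> U)"

lemma norm_abs_completion:
  "seminorm_Cauchy X \<Longrightarrow> (\<lambda>n. seminorm (X n)) \<longlonglongrightarrow> norm (abs_completion X)"
  by (simp add: norm_completion.abs_eq completion_rel_refl)
    (rule seminorm_convergent[THEN convergent_LIMSEQ_iff[THEN iffD1]])

lemma abs_completion_cases:
  obtains X where "seminorm_Cauchy X" "u = abs_completion X"
  using completion.abs_induct[of "\<lambda>u. \<exists>X. seminorm_Cauchy X \<and> u = abs_completion X" u]
  by (auto simp: completion_rel_refl)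

instance
proof
  fix u v :: "'a completion" and r s :: real
  show "r *\<^sub>R (u + v) = r *\<^sub>R u + r *\<^sub>R v" "(r + s) *\<^sub>R u = r *\<^sub>R u + s *\<^sub>R u"
    "r *\<^sub>R s *\<^sub>R u = (r * s) *\<^sub>R u" "1 *\<^sub>R u = u"
    by (simp_all add: scaleR_completion_def scaleC_add_right scaleC_add_left scaleC_scaleC scaleC_one)
  show "dist u v = norm (u - v)" "sgn u = inverse (norm u) *\<^sub>R u"
    by (simp_all add: dist_completion_def sgn_completion_def)
  show "uniformity = (INF e\<in>{0<..}. principal {(u :: 'a completion, v). dist u v < e})"
    by (rule uniformity_completion_def)
  show "open U \<longleftrightarrow> (\<forall>u\<in>U. \<forall>\<^sub>F (v, w) in uniformity. v = u \<longrightarrow> w \<in> U)" for U :: "'a completion set"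
    by (rule open_completion_def)
  obtain X where X: "seminorm_Cauchy X" "u = abs_completion X"
    by (rule abs_completion_cases)
  obtain Y where Y: "seminorm_Cauchy Y" "v = abs_completion Y"
    by (rule abs_completion_cases)
  note X' = norm_abs_completion[OF X(1), folded X(2)]
  show "norm u = 0 \<longleftrightarrow> u = 0"
  proof
    assume "norm u = 0"
    with X' have "completion_rel X (\<lambda>n. 0)"
      using X by (simp add: completion_rel_def)
    then show "u = 0"
      unfolding X(2) zero_completion_def using Quotient3_rel[OF Quotient3_completion] by fastforce
  next
    assume "u = 0"
    then show "norm u = 0"
      by (simp add: zero_completion_def norm_completion.abs_eq completion_rel_refl)
  qed
  have "u + v = abs_completion (\<lambda>n. X n + Y n)"
    using X Y by (simp add: plus_completion.abs_eq completion_rel_refl)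
  then have "(\<lambda>n. seminorm (X n + Y n)) \<longlonglongrightarrow> norm (u + v)"
    using norm_abs_completion[OF seminorm_Cauchy_add[OF X(1) Y(1)]] by simp
  then show "norm (u + v) \<le> norm u + norm v"
    by (rule LIMSEQ_le[OF _ tendsto_add[OF X' norm_abs_completion[OF Y(1), folded Y(2)]]])
      (auto intro: seminorm_triangle)
  have "r *\<^sub>R u = abs_completion (\<lambda>n. complex_of_real r *\<^sub>C X n)"
    using X by (simp add: scaleR_completion_def scaleC_completion.abs_eq completion_rel_refl)
  then have "(\<lambda>n. \<bar>r\<bar> * seminorm (X n)) \<longlonglongrightarrow> norm (r *\<^sub>R u)"
    using norm_abs_completion[OF seminorm_Cauchy_scaleC[OF X(1), of "complex_of_real r"]] by (simp add: seminorm_scaleC)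
  then show "norm (r *\<^sub>R u) = \<bar>r\<bar> * norm u"
    using LIMSEQ_unique tendsto_mult_left[OF X'] by blast
qed

end

lift_definition to_completion :: "'v::complex_seminormed \<Rightarrow> 'v completion" is "\<lambda>x n. x"
  by (simp add: completion_rel_refl)

lemma norm_embed: "norm (to_completion x) = seminorm x"
  by transfer simp

lemma clinear_embed: "clinear to_completion"
  by (rule clinearI; transfer) (simp_all add: completion_rel_refl)

lemma embed_tendsto:
  assumes X: "seminorm_Cauchy X"
  shows "(\<lambda>n. to_completion (X n)) \<longlonglongrightarrow> abs_completion X"
proof (rule metric_LIMSEQ_I)
  fix e :: real
  assume "e > 0"
  then have "e / 2 > 0" by simp
  then obtain M where M: "\<forall>m\<ge>M. \<forall>n\<ge>M. seminorm (X m - X n) < e / 2"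
    using X unfolding seminorm_Cauchy_def by meson
  have "dist (to_completion (X m)) (abs_completion X) < e" if "m \<ge> M" for m
  proof -
    have "to_completion (X m) - abs_completion X = abs_completion (\<lambda>n. X m - X n)"
      using X by (simp add: to_completion.abs_eq minus_completion.abs_eq completion_rel_refl)
    then have "(\<lambda>n. seminorm (X m - X n)) \<longlonglongrightarrow> norm (to_completion (X m) - abs_completion X)"
      using norm_abs_completion[OF seminorm_Cauchy_diff[OF seminorm_Cauchy_const X]] by simp
    then have "norm (to_completion (X m) - abs_completion X) \<le> e / 2"
      by (rule LIMSEQ_le_const2) (use M that less_imp_le in blast)
    with \<open>e > 0\<close> show ?thesis by (simp add: dist_norm)
  qed
  then show "\<exists>M. \<forall>n\<ge>M. dist (to_completion (X n)) (abs_completion X) < e" by blast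
qed

instance completion :: (complex_seminormed) banach
proof
  fix U :: "nat \<Rightarrow> 'a completion"
  assume U: "Cauchy U"
  have "\<exists>x. dist (to_completion x) (U n) < inverse (real (Suc n))" for n
  proof -
    obtain X where X: "seminorm_Cauchy X" "U n = abs_completion X"
      by (rule abs_completion_cases)
    have "\<forall>\<^sub>F m in sequentially. dist (to_completion (X m)) (U n) < inverse (real (Suc n))"
      using embed_tendsto[OF X(1)] unfolding X(2) by (rule tendstoD) simp
    then show ?thesis
      using eventually_happens by fastforce
  qed
  then obtain x where x: "\<And>n. dist (to_completion (x n)) (U n) < inverse (real (Suc n))"
    by metis
  have xU: "(\<lambda>n. to_completion (x n) - U n) \<longlonglongrightarrow> 0"
    by (rule tendsto_norm_zero_cancel, rule tendsto_sandwich[OF _ _ tendsto_const LIMSEQ_inverse_real_of_nat])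
      (use x[unfolded dist_norm, THEN less_imp_le] in \<open>auto intro: always_eventually\<close>)
  have "seminorm_Cauchy x"
    unfolding seminorm_Cauchy_def
  proof (intro allI impI)
    fix e :: real
    assume "e > 0"
    then have e: "e / 3 > 0" by simp
    obtain N where N: "inverse (real (Suc N)) < e / 3"
      using reals_Archimedean[OF e] by blast
    obtain M where M: "\<And>m n. m \<ge> M \<Longrightarrow> n \<ge> M \<Longrightarrow> dist (U m) (U n) < e / 3"
      using U e unfolding Cauchy_def by blast
    have close: "dist (to_completion (x n)) (U n) < e / 3" if "n \<ge> N" for n
    proof -
      have "inverse (real (Suc n)) \<le> inverse (real (Suc N))"
        using that by (simp add: field_simps)
      with x[of n] N show ?thesis by linarith
    qed
    have "seminorm (x m - x n) < e" if "m \<ge> max M N" "n \<ge> max M N" for m n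
    proof -
      have "seminorm (x m - x n) = dist (to_completion (x m)) (to_completion (x n))"
        by (simp add: dist_norm norm_embed flip: cvec.linear_diff[OF clinear_embed])
      also have "\<dots> \<le> dist (to_completion (x m)) (U m) + dist (U m) (U n) + dist (to_completion (x n)) (U n)"
        using dist_triangle[of "to_completion (x m)" "to_completion (x n)" "U m"] dist_triangle[of "U m" "to_completion (x n)" "U n"]
        by (simp add: dist_commute)
      also have "\<dots> < e"
        using close[of m] close[of n] M[of m n] that by simp
      finally show ?thesis .
    qed
    then show "\<exists>M. \<forall>m\<ge>M. \<forall>n\<ge>M. seminorm (x m - x n) < e" by blast
  qed
  then have "(\<lambda>n. to_completion (x n) - (to_completion (x n) - U n)) \<longlonglongrightarrow> abs_completion x - 0"
    by (intro tendsto_diff embed_tendsto xU)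
  then show "convergent U"
    by (auto simp: convergent_def)
qed



definition word_sum :: "(complex \<times> 'a::complex_vector list) list \<Rightarrow> 'a tensor" where
  "word_sum W = (\<Sum>(c, xs)\<leftarrow>W. c *\<^sub>C pure xs)"

definition word_cost :: "(complex \<times> 'a::real_normed_vector list) list \<Rightarrow> real" where
  "word_cost W = (\<Sum>(c, xs)\<leftarrow>W. cmod c * (\<Prod>x\<leftarrow>xs. norm x))"

lemma word_sum_simps [simp]:
  "word_sum [] = 0" "word_sum ((c, xs) # W) = c *\<^sub>C pure xs + word_sum W"
  "word_sum (V @ W) = word_sum V + word_sum W"
  by (simp_all add: word_sum_def)

lemma word_cost_simps [simp]:
  "word_cost [] = 0" "word_cost ((c, xs) # W) = cmod c * (\<Prod>x\<leftarrow>xs. norm x) + word_cost W"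
  "word_cost (V @ W) = word_cost V + word_cost W"
  by (simp_all add: word_cost_def)

lemma prod_norm_nonneg: "0 \<le> (\<Prod>x\<leftarrow>xs. norm x)"
  by (induction xs) simp_all

lemma word_cost_nonneg: "0 \<le> word_cost W"
  by (induction W) (auto simp: prod_norm_nonneg)

lemma word_sum_map_scale: "word_sum (map (\<lambda>(c, xs). (d * c, xs)) W) = d *\<^sub>C word_sum W"
  by (induction W) (auto simp: scaleC_add_right scaleC_scaleC)

lemma word_cost_map_scale: "word_cost (map (\<lambda>(c, xs). (d * c, xs)) W) = cmod d * word_cost W"
  by (induction W) (auto simp: norm_mult algebra_simps)

lemma word_sum_exists: "\<exists>W. u = word_sum W"
proof -
  obtain F where F: "u = free_lift pure F"
    using tensor_expand by blast
  have "\<exists>W. (\<Sum>x\<in>A. Poly_Mapping.lookup F x *\<^sub>C pure x) = word_sum W" if "finite A" for A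
    using that
  proof induction
    case empty
    then show ?case by (auto intro: exI[of _ "[]"])
  next
    case (insert x A)
    then obtain W where "(\<Sum>x\<in>A. Poly_Mapping.lookup F x *\<^sub>C pure x) = word_sum W" by blast
    with insert show ?case
      by (auto intro!: exI[of _ "(Poly_Mapping.lookup F x, x) # W"])
  qed
  from this[of "Poly_Mapping.keys F"] F show ?thesis
    by (simp add: free_lift_def)
qed

text \<open>
  The projective seminorm. For a tensor of homogeneous degree the words of other lengths in an
  expression do not matter, so it is the usual projective norm; see \<open>seminorm_chains\<close> below.
\<close>

instantiation tensor :: (complex_banach_algebra_1) complex_seminormed
begin

definition seminorm_tensor :: "'a tensor \<Rightarrow> real" where
  "seminorm_tensor u = Inf {word_cost W |W. u = word_sum W}"

lemma seminorm_word_sum_le: "seminorm (word_sum W) \<le> word_cost (W :: (complex \<times> 'a list) list)"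
  unfolding seminorm_tensor_def
  by (rule cInf_lower) (auto intro!: bdd_belowI[of _ 0] word_cost_nonneg)

lemma seminorm_tensor_approx:
  fixes u :: "'a tensor"
  assumes "e > 0"
  obtains W where "u = word_sum W" "word_cost W < seminorm u + e"
proof -
  have "\<exists>r\<in>{word_cost W |W. u = word_sum W}. r < seminorm u + e"
    by (rule cInf_lessD) (use assms word_sum_exists[of u] in \<open>auto simp: seminorm_tensor_def\<close>)
  with that show ?thesis by blast
qed

lemma seminorm_tensor_nonneg: "0 \<le> seminorm (u :: 'a tensor)"
  unfolding seminorm_tensor_def
  by (rule cInf_greatest) (use word_sum_exists[of u] word_cost_nonneg in auto)

instance
proof
  fix u v :: "'a tensor" and c :: complex
  show "seminorm (u + v) \<le> seminorm u + seminorm v"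
  proof (rule field_le_epsilon)
    fix e :: real assume "e > 0"
    then have "e / 2 > 0" by simp
    obtain V where V: "u = word_sum V" "word_cost V < seminorm u + e / 2"
      using \<open>e / 2 > 0\<close> by (rule seminorm_tensor_approx)
    obtain W where W: "v = word_sum W" "word_cost W < seminorm v + e / 2"
      using \<open>e / 2 > 0\<close> by (rule seminorm_tensor_approx)
    show "seminorm (u + v) \<le> seminorm u + seminorm v + e"
      using seminorm_word_sum_le[of "V @ W"] V W by simp
  qed
  have le: "seminorm (c *\<^sub>C u) \<le> cmod c * seminorm u" for c and u :: "'a tensor"
  proof (cases "c = 0")
    case True
    then show ?thesis
      using seminorm_word_sum_le[of "[] :: (complex \<times> 'a list) list"] by simp
  next
    case False
    show ?thesis
    proof (rule field_le_epsilon)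
      fix e :: real assume "e > 0"
      with False have "e / cmod c > 0" by simp
      then obtain W where W: "u = word_sum W" "word_cost W < seminorm u + e / cmod c"
        by (rule seminorm_tensor_approx)
      have "seminorm (c *\<^sub>C u) \<le> cmod c * word_cost W"
        using seminorm_word_sum_le[of "map (\<lambda>(d, xs). (c * d, xs)) W"] W(1)
        by (simp only: word_sum_map_scale word_cost_map_scale)
      also have "\<dots> \<le> cmod c * (seminorm u + e / cmod c)"
        using W(2) by (intro mult_left_mono) simp_all
      also have "\<dots> = cmod c * seminorm u + e"
        using False by (simp add: field_simps)
      finally show "seminorm (c *\<^sub>C u) \<le> cmod c * seminorm u + e" .
    qed
  qed
  show "seminorm (c *\<^sub>C u) = cmod c * seminorm u"
  proof (cases "c = 0")
    case True
    then show ?thesis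
      using le[of 0 u] seminorm_tensor_nonneg[of "c *\<^sub>C u"] by simp
  next
    case False
    have "cmod c * seminorm u = cmod c * seminorm (inverse c *\<^sub>C c *\<^sub>C u)"
      using False by (simp add: scaleC_scaleC scaleC_one)
    also have "\<dots> \<le> cmod c * (cmod (inverse c) * seminorm (c *\<^sub>C u))"
      by (intro mult_left_mono le) simp
    also have "\<dots> = seminorm (c *\<^sub>C u)"
      using False by (simp add: norm_inverse)
    finally show ?thesis using le[of c u] by simp
  qed
qed

end

lemma multilinear_degree_word: "multilinear (\<lambda>xs. if length xs = n then pure xs else 0)"
  by (rule multilinear_if[where P = "\<lambda>m. m = n", OF multilinear_pure multilinear_0])

lemma chains_word_sum:
  assumes "u \<in> hochschild_chains k" "u = word_sum W"
  shows "u = word_sum (filter (\<lambda>(c, xs). length xs = Suc k) W)"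
proof -
  define p :: "'a tensor \<Rightarrow> 'a tensor" where "p = tensor_lift (\<lambda>xs. if length xs = Suc k then pure xs else 0)"
  have p: "clinear p"
    unfolding p_def by (rule clinear_tensor_lift[OF multilinear_degree_word])
  have p_pure: "p (pure xs) = (if length xs = Suc k then pure xs else 0)" for xs
    unfolding p_def by (rule tensor_lift_pure[OF multilinear_degree_word])
  have "p u = u"
    using assms(1) unfolding hochschild_chains_def
  proof (induction rule: cvec.span_induct)
    case base
    show ?case
      by (rule cvec.subspaceI) (simp_all add: cvec.linear_0[OF p] cvec.linear_add[OF p] cvec.linear_scale[OF p])
  qed (auto simp: p_pure)
  moreover have "p (word_sum V) = word_sum (filter (\<lambda>(c, xs). length xs = Suc k) V)" for V
    by (induction V) (auto simp: cvec.linear_0[OF p] cvec.linear_add[OF p] cvec.linear_scale[OF p] p_pure)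
  ultimately show ?thesis
    using assms(2) by metis
qed

lemma word_cost_filter_le: "word_cost (filter P W) \<le> word_cost W"
  by (induction W) (auto simp: prod_norm_nonneg add_increasing)

lemma seminorm_chains:
  assumes "u \<in> hochschild_chains k"
  shows "seminorm u = Inf {word_cost W |W. u = word_sum W \<and> (\<forall>(c, xs)\<in>set W. length xs = Suc k)}"
    (is "_ = Inf ?S")
proof (rule antisym)
  have ne: "?S \<noteq> {}"
    using word_sum_exists[of u] chains_word_sum[OF assms] by fastforce
  then show "seminorm u \<le> Inf ?S"
    by (rule cInf_greatest) (auto intro: seminorm_word_sum_le)
  show "Inf ?S \<le> seminorm u"
    unfolding seminorm_tensor_def
  proof (rule cInf_greatest)
    show "{word_cost W |W. u = word_sum W} \<noteq> {}"
      using word_sum_exists[of u] by blast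
    fix r assume "r \<in> {word_cost W |W. u = word_sum W}"
    then obtain W where W: "u = word_sum W" "r = word_cost W" by blast
    have "Inf ?S \<le> word_cost (filter (\<lambda>(c, xs). length xs = Suc k) W)"
      by (rule cInf_lower) (use chains_word_sum[OF assms W(1)] in \<open>auto intro!: bdd_belowI[of _ 0] word_cost_nonneg\<close>)
    then show "Inf ?S \<le> r"
      using word_cost_filter_le W(2) order_trans by blast
  qed
qed

lemma seminorm_pure_le: "seminorm (pure xs) \<le> (\<Prod>x\<leftarrow>xs. norm x)"
  using seminorm_word_sum_le[of "[(1, xs)]"] by (simp add: scaleC_one)

lemma seminorm_chains_bound:
  assumes "u \<in> hochschild_chains k" "clinear f" "0 \<le> K"
    and bound: "\<And>xs. length xs = Suc k \<Longrightarrow> seminorm (f (pure xs)) \<le> K * (\<Prod>x\<leftarrow>xs. norm x)"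
  shows "seminorm (f u) \<le> K * seminorm u"
proof (rule field_le_epsilon)
  fix e :: real assume "e > 0"
  with \<open>0 \<le> K\<close> have "e / (K + 1) > 0" by simp
  then obtain W where W: "u = word_sum W" "word_cost W < seminorm u + e / (K + 1)"
    by (rule seminorm_tensor_approx)
  let ?V = "filter (\<lambda>(c, xs). length xs = Suc k) W"
  have "seminorm (f (word_sum V)) \<le> K * word_cost V" if "\<forall>(c, xs)\<in>set V. length xs = Suc k" for V
    using that
  proof (induction V)
    case (Cons z V)
    obtain c xs where z: "z = (c, xs)" by (cases z)
    have "seminorm (f (word_sum (z # V))) \<le> cmod c * seminorm (f (pure xs)) + seminorm (f (word_sum V))"
      using seminorm_triangle[of "c *\<^sub>C f (pure xs)" "f (word_sum V)"]
      by (simp add: z cvec.linear_add[OF assms(2)] cvec.linear_scale[OF assms(2)] seminorm_scaleC)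
    also have "\<dots> \<le> cmod c * (K * (\<Prod>x\<leftarrow>xs. norm x)) + K * word_cost V"
      using Cons z by (intro add_mono mult_left_mono bound) auto
    finally show ?case by (simp add: z algebra_simps)
  qed (simp add: cvec.linear_0[OF assms(2)])
  from this[of ?V] have "seminorm (f u) \<le> K * word_cost ?V"
    using chains_word_sum[OF assms(1) W(1)] by auto
  also have "\<dots> \<le> K * (seminorm u + e / (K + 1))"
    using W(2) word_cost_filter_le[of "\<lambda>(c, xs). length xs = Suc k" W] \<open>0 \<le> K\<close> by (intro mult_left_mono) linarith+
  also have "\<dots> \<le> K * seminorm u + e"
    using \<open>0 \<le> K\<close> \<open>e > 0\<close> by (simp add: field_simps)
  finally show "seminorm (f u) \<le> K * seminorm u + e" .
qed

text \<open>
  The closure of the homogeneous part of degree \<open>k\<close> in the completion of the whole tensor algebra.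
  By \<open>seminorm_chains\<close> this is the completion of \<open>hochschild_chains k\<close> for its projective norm, that is, the
  projective tensor power with \<open>k + 1\<close> factors.
\<close>

definition top_chains :: "nat \<Rightarrow> 'b::complex_banach_algebra_1 tensor completion set" where
  "top_chains k = closure (to_completion ` hochschild_chains k)"

text \<open>
  Extension by continuity from \<open>hochschild_chains k\<close> to \<open>top_chains k\<close>. The degree is an argument because the
  Hochschild boundary is bounded in each degree but not uniformly in the degree. For bounded
  operators the description is unique, see \<open>extend_tendsto\<close>; \<open>boundary_bound\<close> and \<open>cyc_bound\<close>
  show that it applies.
\<close>

definition extend :: "nat \<Rightarrow> ('b::complex_banach_algebra_1 tensor \<Rightarrow> 'b tensor) \<Rightarrow> 'b tensor completion \<Rightarrow> 'b tensor completion"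
  where "extend k f u = (THE v. \<exists>X. (\<forall>i. X i \<in> hochschild_chains k) \<and>
    (\<lambda>i. to_completion (X i)) \<longlonglongrightarrow> u \<and> (\<lambda>i. to_completion (f (X i))) \<longlonglongrightarrow> v)"

definition boundary_top :: "nat \<Rightarrow> 'b::complex_banach_algebra_1 tensor completion \<Rightarrow> 'b tensor completion" where
  "boundary_top k = extend k boundary"

definition cyc_top :: "nat \<Rightarrow> 'b::complex_banach_algebra_1 tensor completion \<Rightarrow> 'b tensor completion" where
  "cyc_top k = extend k cyc"

lemma chains_diff: "u \<in> hochschild_chains k \<Longrightarrow> v \<in> hochschild_chains k \<Longrightarrow> u - v \<in> hochschild_chains k"
  unfolding hochschild_chains_def by (rule cvec.span_diff)

lemma extend_tendsto:
  assumes f: "clinear f" and bound: "\<And>w. w \<in> hochschild_chains k \<Longrightarrow> seminorm (f w) \<le> K * seminorm w"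
    and X: "\<And>i. X i \<in> hochschild_chains k" "(\<lambda>i. to_completion (X i)) \<longlonglongrightarrow> u"
  shows "(\<lambda>i. to_completion (f (X i))) \<longlonglongrightarrow> extend k f u"
proof -
  have diff: "norm (to_completion (f v) - to_completion (f w)) \<le> K * norm (to_completion v - to_completion w)"
    if "v \<in> hochschild_chains k" "w \<in> hochschild_chains k" for v w
    using bound[OF chains_diff[OF that]]
    by (simp add: cvec.linear_diff[OF f] norm_embed flip: cvec.linear_diff[OF clinear_embed])
  have "seminorm_Cauchy X"
    using LIMSEQ_imp_Cauchy[OF X(2)] unfolding Cauchy_def seminorm_Cauchy_def
    by (simp add: dist_norm norm_embed flip: cvec.linear_diff[OF clinear_embed])
  then have "seminorm_Cauchy (\<lambda>i. f (X i))"
    by (rule seminorm_Cauchy_lipschitz[where K = K])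
      (use bound[OF chains_diff] X in \<open>simp add: flip: cvec.linear_diff[OF f]\<close>)
  then obtain v where v: "(\<lambda>i. to_completion (f (X i))) \<longlonglongrightarrow> v"
    using embed_tendsto by blast
  have "extend k f u = v"
    unfolding extend_def
  proof (rule the_equality)
    show "\<exists>X. (\<forall>i. X i \<in> hochschild_chains k) \<and> (\<lambda>i. to_completion (X i)) \<longlonglongrightarrow> u \<and> (\<lambda>i. to_completion (f (X i))) \<longlonglongrightarrow> v"
      using X v by blast
    fix w assume "\<exists>Y. (\<forall>i. Y i \<in> hochschild_chains k) \<and> (\<lambda>i. to_completion (Y i)) \<longlonglongrightarrow> u \<and> (\<lambda>i. to_completion (f (Y i))) \<longlonglongrightarrow> w"
    then obtain Y where Y: "\<And>i. Y i \<in> hochschild_chains k" "(\<lambda>i. to_completion (Y i)) \<longlonglongrightarrow> u" "(\<lambda>i. to_completion (f (Y i))) \<longlonglongrightarrow> w"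
      by blast
    have "(\<lambda>i. K * norm (to_completion (Y i) - to_completion (X i))) \<longlonglongrightarrow> K * norm (u - u)"
      by (intro tendsto_intros X Y)
    then have null: "(\<lambda>i. K * norm (to_completion (Y i) - to_completion (X i))) \<longlonglongrightarrow> 0"
      by simp
    have "(\<lambda>i. to_completion (f (Y i)) - to_completion (f (X i))) \<longlonglongrightarrow> 0"
      by (rule Lim_null_comparison[OF always_eventually null]) (intro allI diff X Y)
    moreover have "(\<lambda>i. to_completion (f (Y i)) - to_completion (f (X i))) \<longlonglongrightarrow> w - v"
      by (intro tendsto_intros v Y)
    ultimately show "w = v"
      using LIMSEQ_unique by fastforce
  qed
  with v show ?thesis by simp
qed

lemma prod_norm_split:
  assumes "Suc i < length xs"
  shows "(\<Prod>x\<leftarrow>take i xs @ (xs ! i * xs ! (i + 1)) # drop (i + 2) xs. norm x)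
    \<le> (\<Prod>x\<leftarrow>xs. norm (x :: 'b::complex_banach_algebra_1))"
proof -
  have "xs = take i xs @ xs ! i # xs ! (i + 1) # drop (i + 2) xs"
    using assms by (simp add: Cons_nth_drop_Suc)
  then have "(\<Prod>x\<leftarrow>xs. norm x) = (\<Prod>x\<leftarrow>take i xs @ xs ! i # xs ! (i + 1) # drop (i + 2) xs. norm x)"
    by (rule arg_cong)
  also have "\<dots> = (\<Prod>x\<leftarrow>take i xs. norm x) * ((norm (xs ! i) * norm (xs ! (i + 1))) * (\<Prod>x\<leftarrow>drop (i + 2) xs. norm x))"
    by (simp add: mult.assoc)
  finally have eq: "(\<Prod>x\<leftarrow>xs. norm x) = \<dots>" .
  show ?thesis
    unfolding eq by (simp add: mult_left_mono mult_right_mono norm_mult_ineq prod_norm_nonneg)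
qed

lemma boundary_bound:
  assumes "u \<in> hochschild_chains k"
  shows "seminorm (boundary u) \<le> real (Suc k) * seminorm u"
proof (rule seminorm_chains_bound[OF assms clinear_boundary])
  fix xs :: "'a list"
  assume len: "length xs = Suc k"
  let ?p = "\<Prod>x\<leftarrow>xs. norm x"
  show "seminorm (boundary (pure xs)) \<le> real (Suc k) * ?p"
  proof (cases "k = 0")
    case True
    then show ?thesis
      using len by (simp add: boundary_pure boundary_word_def prod_norm_nonneg)
  next
    case False
    let ?m = "\<lambda>i. pure (take i xs @ (xs ! i * xs ! (i + 1)) # drop (i + 2) xs)"
    let ?w = "pure ((xs ! k * xs ! 0) # take (k - 1) (drop 1 xs))"
    have "boundary (pure xs) = (\<Sum>i<k. (-1) ^ i *\<^sub>C ?m i) + (-1) ^ k *\<^sub>C ?w"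
      using len False by (simp add: boundary_pure boundary_word_def)
    then have "seminorm (boundary (pure xs)) \<le> (\<Sum>i<k. seminorm (?m i)) + seminorm ?w"
      using seminorm_triangle[of "\<Sum>i<k. (-1) ^ i *\<^sub>C ?m i" "(-1) ^ k *\<^sub>C ?w"]
        seminorm_sum_le[of "\<lambda>i. (-1) ^ i *\<^sub>C ?m i" "{..<k}"]
      by (simp add: seminorm_scaleC norm_power)
    also have "\<dots> \<le> (\<Sum>i<k. ?p) + ?p"
    proof (intro add_mono sum_mono)
      show "seminorm (?m i) \<le> ?p" if "i \<in> {..<k}" for i
        using order_trans[OF seminorm_pure_le prod_norm_split[of i xs]] that len by simp
      obtain a ys b where xs: "xs = a # ys @ [b]"
        using len False by (metis Suc_length_conv length_0_conv rev_exhaust)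
      then have "?w = pure ((b * a) # ys)"
        using len by (auto simp: nth_append)
      then have "seminorm ?w \<le> norm (b * a) * (\<Prod>x\<leftarrow>ys. norm x)"
        using seminorm_pure_le[of "(b * a) # ys"] by simp
      also have "\<dots> \<le> (norm b * norm a) * (\<Prod>x\<leftarrow>ys. norm x)"
        by (intro mult_right_mono norm_mult_ineq prod_norm_nonneg)
      finally show "seminorm ?w \<le> ?p"
        by (simp add: xs mult_ac)
    qed
    finally show ?thesis by (simp add: algebra_simps)
  qed
qed simp

lemma cyc_bound:
  assumes "u \<in> hochschild_chains k"
  shows "seminorm (cyc u) \<le> 1 * seminorm u"
proof (rule seminorm_chains_bound[OF assms clinear_cyc])
  fix xs :: "'a list"
  assume "length xs = Suc k"
  then obtain ys y where "xs = ys @ [y]"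
    by (metis length_0_conv nat.simps(3) rev_exhaust)
  then show "seminorm (cyc (pure xs)) \<le> 1 * (\<Prod>x\<leftarrow>xs. norm x)"
    using seminorm_pure_le[of "y # ys"] by (simp add: cyc_pure seminorm_scaleC norm_power mult.commute)
qed simp

lemma boundary_top_tendsto:
  assumes "\<And>i. X i \<in> hochschild_chains k" "(\<lambda>i. to_completion (X i)) \<longlonglongrightarrow> u"
  shows "(\<lambda>i. to_completion (boundary (X i))) \<longlonglongrightarrow> boundary_top k u"
  unfolding boundary_top_def by (rule extend_tendsto[OF clinear_boundary _ assms]) (rule boundary_bound)

lemma cyc_top_tendsto:
  assumes "\<And>i. X i \<in> hochschild_chains k" "(\<lambda>i. to_completion (X i)) \<longlonglongrightarrow> u"
  shows "(\<lambda>i. to_completion (cyc (X i))) \<longlonglongrightarrow> cyc_top k u"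
  unfolding cyc_top_def by (rule extend_tendsto[OF clinear_cyc _ assms]) (rule cyc_bound)

lemma boundary_top_embed:
  assumes "u \<in> hochschild_chains k"
  shows "boundary_top k (to_completion u) = to_completion (boundary u)"
proof -
  have "(\<lambda>i::nat. to_completion (boundary u)) \<longlonglongrightarrow> boundary_top k (to_completion u)"
    by (rule boundary_top_tendsto[where X = "\<lambda>i. u", OF assms tendsto_const])
  then show ?thesis
    by (rule LIMSEQ_unique) (rule tendsto_const)
qed

lemma cyc_top_embed:
  assumes "u \<in> hochschild_chains k"
  shows "cyc_top k (to_completion u) = to_completion (cyc u)"
proof -
  have "(\<lambda>i::nat. to_completion (cyc u)) \<longlonglongrightarrow> cyc_top k (to_completion u)"
    by (rule cyc_top_tendsto[where X = "\<lambda>i. u", OF assms tendsto_const])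
  then show ?thesis
    by (rule LIMSEQ_unique) (rule tendsto_const)
qed

text \<open>Elements of a quotient \<open>V / W\<close> are the cosets \<open>v + W\<close>, subtracted elementwise.\<close>

definition coset :: "'v::ab_group_add set \<Rightarrow> 'v \<Rightarrow> 'v set" where
  "coset W v = {v + w |w. w \<in> W}"

definition coset_diff :: "'v::ab_group_add set \<Rightarrow> 'v set \<Rightarrow> 'v set" where
  "coset_diff X Y = {u - v |u v. u \<in> X \<and> v \<in> Y}"

definition cyc_image :: "nat \<Rightarrow> 'a::complex_vector tensor set" where
  "cyc_image k = (\<lambda>u. u - cyc u) ` hochschild_chains k"

definition cyclic_chains :: "nat \<Rightarrow> 'a::complex_vector tensor set set" where
  "cyclic_chains k = coset (cyc_image k) ` hochschild_chains k"

definition cyc_image_top :: "nat \<Rightarrow> 'b::complex_banach_algebra_1 tensor completion set" where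
  "cyc_image_top k = (\<lambda>u. u - cyc_top k u) ` top_chains k"

text \<open>The common value of \<open>B\<close> on all representatives; see \<open>connes_cyclic_coset\<close>.\<close>

definition connes_cyclic :: "nat \<Rightarrow> 'a::complex_algebra_1 tensor set \<Rightarrow> 'a tensor" where
  "connes_cyclic k X = the_elem (connes k ` X)"

definition push :: "('a::complex_vector \<Rightarrow> 'b::complex_vector) \<Rightarrow> 'a tensor \<Rightarrow> 'b tensor" where
  "push f = tensor_lift (\<lambda>xs. pure (map f xs))"

text \<open>
  The map on cosets induced by \<open>f\<close>: as \<open>f\<close> sends \<open>Im (1 - t)\<close> into \<open>Im (1 - t)\<close>, the
  cosets in the union coincide.
\<close>

definition push_cyclic ::
  "nat \<Rightarrow> ('a::complex_vector \<Rightarrow> 'b::complex_banach_algebra_1) \<Rightarrow> 'a tensor set \<Rightarrow> 'b tensor completion set" where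
  "push_cyclic k f X = (\<Union>u\<in>X. coset (cyc_image_top k) (to_completion (push f u)))"

text \<open>
  At the end points of \<open>[0, 1]\<close> the derivative is one-sided. Only words with at least two letters,
  that is, chains of positive degree, are relevant.
\<close>

definition transgression_word ::
  "(real \<Rightarrow> 'a::complex_algebra_1 \<Rightarrow> 'b::complex_banach_algebra_1) \<Rightarrow> 'a list \<Rightarrow> 'b tensor completion" where
  "transgression_word \<pi> xs = (case xs of
     x0 # x1 # ys \<Rightarrow> integral {0..1} (\<lambda>s. to_completion (pure
       ((\<pi> s x0 * vector_derivative (\<lambda>t. \<pi> t x1) (at s within {0..1})) # map (\<pi> s) ys)))
   | _ \<Rightarrow> 0)"

definition transgression ::
  "(real \<Rightarrow> 'a::complex_algebra_1 \<Rightarrow> 'b::complex_banach_algebra_1) \<Rightarrow> 'a tensor \<Rightarrow> 'b tensor completion" where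
  "transgression \<pi> = tensor_lift (transgression_word \<pi>)"

lemma chains_scaleC: "u \<in> hochschild_chains k \<Longrightarrow> c *\<^sub>C u \<in> hochschild_chains k"
  unfolding hochschild_chains_def by (rule cvec.span_scale)

lemma cyc_chains:
  assumes "u \<in> hochschild_chains k"
  shows "cyc u \<in> hochschild_chains k"
  using assms unfolding hochschild_chains_def
proof (induction rule: cvec.span_induct)
  case base
  show ?case
    by (rule cvec.subspaceI)
      (simp_all add: cvec.linear_0[OF clinear_cyc] cvec.linear_add[OF clinear_cyc] cvec.linear_scale[OF clinear_cyc]
        cvec.span_zero cvec.span_add cvec.span_scale)
next
  case (step u)
  then obtain xs where xs: "u = pure xs" "length xs = Suc k"
    by blast
  have "cyc u \<in> hochschild_chains k"
    unfolding xs(1) cyc_pure by (intro chains_scaleC pure_in_chains) (simp add: xs(2))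
  then show ?case
    by (simp only: hochschild_chains_def)
qed

lemma norm_op_add: "norm_op k (u + v) = norm_op k u + norm_op k v"
  by (simp add: norm_op_def cvec.linear_add[OF clinear_cyc_pow] sum.distrib)

lemma norm_op_diff: "norm_op k (u - v) = norm_op k u - norm_op k v"
  by (simp add: norm_op_def cvec.linear_diff[OF clinear_cyc_pow] sum_subtractf)

lemma connes_cyclic_coset:
  assumes "u \<in> hochschild_chains k"
  shows "connes_cyclic k (coset (cyc_image k) u) = connes k u"
proof -
  have 0: "0 \<in> (hochschild_chains k :: 'a tensor set)"
    unfolding hochschild_chains_def by (rule cvec.span_zero)
  have *: "connes k v = connes k u" if "v \<in> coset (cyc_image k) u" for v
  proof -
    obtain w where w: "w \<in> hochschild_chains k" and v: "v = u + (w - cyc w)"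
      using \<open>v \<in> coset (cyc_image k) u\<close> unfolding coset_def cyc_image_def by blast
    have "norm_op k v = norm_op k u"
      unfolding v norm_op_add norm_op_diff norm_op_cyc[OF w] by simp
    then show ?thesis
      unfolding connes_def by simp
  qed
  have "0 - cyc 0 \<in> (cyc_image k :: 'a tensor set)"
    unfolding cyc_image_def by (rule imageI[OF 0])
  then have "u + (0 - cyc 0) \<in> coset (cyc_image k) u"
    unfolding coset_def by blast
  then have "connes k ` coset (cyc_image k) u = {connes k u}"
    using * by (metis (no_types, lifting) image_cong image_constant)
  then show ?thesis
    unfolding connes_cyclic_def by simp
qed

end

theory Submission
  imports Defs
begin

text \<open>
  The formula is a Cartan homotopy argument. Fix \<open>s\<close> and let \<open>d\<close> be the derivative at \<open>s\<close> of \<open>t \<mapsto> \<pi> t a\<close>, as a function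
  of \<open>a\<close>. Differentiating \<open>\<pi> t (a * b) = \<pi> t a * \<pi> t b\<close> shows that \<open>d\<close> is a derivation relative to the homomorphism
  \<open>\<pi> s\<close>. The integrand of the transgression \<open>J\<close> is the contraction \<open>e\<close> with \<open>d\<close>, sending
  \<open>x0 \<otimes> x1 \<otimes> x2 \<otimes> \<dots>\<close> to \<open>x0 dx1 \<otimes> x2 \<otimes> \<dots>\<close>, where undifferentiated letters stand for their images under \<open>\<pi> s\<close>.
  Two algebraic identities hold for it.

  The first is \<open>b e = - e b\<close> (\<open>boundary_contraction\<close>), a consequence of the Leibniz rule. The second is that
  modulo the image of \<open>1 - t\<close> the composition \<open>e B\<close> is the Lie derivative, which maps a word to the sum of all words obtained by
  differentiating one letter (\<open>contraction_connes_pure\<close>). Indeed \<open>d 1 = 0\<close>, so \<open>e\<close> annihilates the part \<open>t s N\<close> of \<open>B\<close>, while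
  \<open>e s\<close> differentiates the first letter of each of the rotations that make up \<open>N\<close>. By the product rule
  the Lie derivative is the derivative of \<open>\<pi> s (x)\<close> with respect to \<open>s\<close>.

  Integrating over \<open>s\<close>, the first identity yields \<open>b (J y) = - J (b y) = - J (B x)\<close> (\<open>boundary_transgression\<close>), and the second
  yields \<open>J (B x) = \<pi> 1 (x) - \<pi> 0 (x)\<close> in the cyclic quotient (\<open>transgression_connes\<close>). Together they give the theorem.

  What analysis requires is that \<open>b\<close> and \<open>t\<close>, extended by continuity to the completion, commute with integrals of
  continuous paths of chains (\<open>integral_extend\<close>), and that words whose letters depend on a parameter may be differentiated
  letter by letter (\<open>has_vector_derivative_pure\<close>).
\<close>

section \<open>Linear maps on tensors and chains\<close>

lemma tensor_induct:
  assumes "\<And>xs. P (pure xs)" "\<And>u v. P u \<Longrightarrow> P v \<Longrightarrow> P (u + v)" "\<And>c u. P u \<Longrightarrow> P (c *\<^sub>C u)"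
  shows "P (u :: 'a::complex_vector tensor)"
proof -
  have zero: "P 0"
    using assms(3)[OF assms(1), of 0] by simp
  obtain W where "u = word_sum W"
    using word_sum_exists by blast
  moreover have "P (word_sum W)"
    by (induction W) (auto intro: zero assms(2)[OF assms(3)[OF assms(1)]])
  ultimately show ?thesis by simp
qed

lemma clinear_compose: "clinear f \<Longrightarrow> clinear g \<Longrightarrow> clinear (\<lambda>x. f (g x))"
  by (rule clinearI) (simp_all add: cvec.linear_add cvec.linear_scale)

lemma clinear_uminus: "clinear f \<Longrightarrow> clinear (\<lambda>x. - f x)"
  by (rule clinearI) (simp_all add: cvec.linear_add cvec.linear_scale)

lemma clinear_eq_on_pure:
  assumes "clinear f" "clinear g" "\<And>xs. f (pure xs) = g (pure xs)"
  shows "f u = g u"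
  by (induction u rule: tensor_induct)
    (simp_all add: assms cvec.linear_add[OF assms(1)] cvec.linear_add[OF assms(2)]
      cvec.linear_scale[OF assms(1)] cvec.linear_scale[OF assms(2)])

lemma multilinear_clinear_pure: "clinear h \<Longrightarrow> multilinear (\<lambda>xs. h (pure xs))"
  by (simp add: multilinear_def pure_update_add pure_update_scaleC cvec.linear_add cvec.linear_scale)

lemma chains_induct [consumes 1, case_names pure add scaleC]:
  assumes "u \<in> hochschild_chains k" "\<And>xs. length xs = Suc k \<Longrightarrow> P (pure xs)"
    "\<And>u v. P u \<Longrightarrow> P v \<Longrightarrow> P (u + v)" "\<And>c u. P u \<Longrightarrow> P (c *\<^sub>C u)"
  shows "P u"
  using assms(1) unfolding hochschild_chains_def
proof (induction rule: cvec.span_induct)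
  case base
  have "P 0"
    using assms(4)[OF assms(2)[of "replicate (Suc k) 0"], of 0] by simp
  then show ?case
    by (intro cvec.subspaceI) (simp_all add: assms)
qed (auto intro: assms)

lemma chains_0: "0 \<in> hochschild_chains k"
  unfolding hochschild_chains_def by (rule cvec.span_zero)

lemma chains_add: "u \<in> hochschild_chains k \<Longrightarrow> v \<in> hochschild_chains k \<Longrightarrow> u + v \<in> hochschild_chains k"
  unfolding hochschild_chains_def by (rule cvec.span_add)

section \<open>Words in the completed tensor algebra\<close>

lemma norm_scaleC_completion: "norm (c *\<^sub>C u) = cmod c * norm (u :: 'v::complex_seminormed completion)"
proof -
  obtain X where X: "seminorm_Cauchy X" "u = abs_completion X"
    by (rule abs_completion_cases)
  have "c *\<^sub>C u = abs_completion (\<lambda>n. c *\<^sub>C X n)"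
    using X by (simp add: scaleC_completion.abs_eq completion_rel_refl)
  then have "(\<lambda>n. cmod c * seminorm (X n)) \<longlonglongrightarrow> norm (c *\<^sub>C u)"
    using norm_abs_completion[OF seminorm_Cauchy_scaleC[OF X(1), of c]] by (simp add: seminorm_scaleC)
  then show ?thesis
    using LIMSEQ_unique tendsto_mult_left[OF norm_abs_completion[OF X(1), folded X(2)]] by blast
qed

lemma bounded_linear_scaleC_completion:
  "bounded_linear (\<lambda>u :: 'v::complex_seminormed completion. c *\<^sub>C u)"
  by (rule bounded_linear_intro[where K = "cmod c"])
    (simp_all add: scaleC_add_right scaleR_completion_def scaleC_scaleC norm_scaleC_completion mult.commute)

lemma bounded_linear_scaleC_banach:
  "bounded_linear (\<lambda>u :: 'v::complex_banach_algebra_1. c *\<^sub>C u)"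
  by (rule bounded_linear_intro[where K = "cmod c"])
    (simp_all add: scaleC_add_right scaleR_scaleC scaleC_scaleC norm_scaleC mult.commute)

text \<open>
  Left multiplication by a letter in the tensor algebra. Its bound \<open>norm a\<close> is the same in all degrees, so it
  extends to the whole completion. As words arise from the empty word by such multiplications, analytic
  properties of a word depending on a parameter follow from those of its letters by induction on the word.
\<close>

definition cons_tensor :: "'a::complex_vector \<Rightarrow> 'a tensor \<Rightarrow> 'a tensor" where
  "cons_tensor a = tensor_lift (\<lambda>xs. pure (a # xs))"

lemma multilinear_cons_word: "multilinear (\<lambda>xs. pure (a # xs))"
  unfolding multilinear_def
proof (intro allI impI)
  fix xs :: "'a list" and i b b' c
  assume "i < length xs"
  then show "pure (a # xs[i := b + b']) = pure (a # xs[i := b]) + pure (a # xs[i := b']) \<and>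
      pure (a # xs[i := c *\<^sub>C b]) = c *\<^sub>C pure (a # xs[i := b])"
    using pure_update_add[of "Suc i" "a # xs"] pure_update_scaleC[of "Suc i" "a # xs"] by simp
qed

lemma clinear_cons_tensor: "clinear (cons_tensor a)"
  unfolding cons_tensor_def by (rule clinear_tensor_lift[OF multilinear_cons_word])

lemma cons_tensor_pure: "cons_tensor a (pure xs) = pure (a # xs)"
  unfolding cons_tensor_def by (rule tensor_lift_pure[OF multilinear_cons_word])

lemma clinear_cons_tensor_left: "clinear (\<lambda>a. cons_tensor a u)"
proof (rule clinearI)
  show "cons_tensor (a + b) u = cons_tensor a u + cons_tensor b u" for a b
    by (induction u rule: tensor_induct)
      (simp_all add: cons_tensor_pure pure_Cons_add cvec.linear_add[OF clinear_cons_tensor]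
        cvec.linear_scale[OF clinear_cons_tensor] scaleC_add_right)
  show "cons_tensor (c *\<^sub>C a) u = c *\<^sub>C cons_tensor a u" for c a
    by (induction u rule: tensor_induct)
      (simp_all add: cons_tensor_pure pure_Cons_scaleC cvec.linear_add[OF clinear_cons_tensor]
        cvec.linear_scale[OF clinear_cons_tensor] scaleC_add_right scaleC_scaleC mult.commute)
qed

lemma seminorm_cons_tensor:
  "seminorm (cons_tensor a u) \<le> norm a * seminorm (u :: 'b::complex_banach_algebra_1 tensor)"
proof (rule field_le_epsilon)
  fix e :: real assume "e > 0"
  then have "e / (norm a + 1) > 0"
    by (simp add: add_nonneg_pos)
  then obtain W where W: "u = word_sum W" "word_cost W < seminorm u + e / (norm a + 1)"
    by (rule seminorm_tensor_approx)
  let ?W = "map (\<lambda>(c, xs). (c, a # xs)) W"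
  have "cons_tensor a (word_sum V) = word_sum (map (\<lambda>(c, xs). (c, a # xs)) V)" for V
    by (induction V) (auto simp: cvec.linear_0[OF clinear_cons_tensor] cvec.linear_add[OF clinear_cons_tensor]
        cvec.linear_scale[OF clinear_cons_tensor] cons_tensor_pure)
  moreover have "word_cost (map (\<lambda>(c, xs). (c, a # xs)) V) = norm a * word_cost V" for V
    by (induction V) (auto simp: algebra_simps)
  ultimately have "seminorm (cons_tensor a u) \<le> norm a * word_cost W"
    using seminorm_word_sum_le[of ?W] W(1) by simp
  also have "\<dots> \<le> norm a * (seminorm u + e / (norm a + 1))"
    using W(2) by (intro mult_left_mono) simp_all
  also have "\<dots> \<le> norm a * seminorm u + e"
  proof -
    have "norm a * (e / (norm a + 1)) \<le> e"
      using \<open>e > 0\<close> mult_right_mono[of "norm a" "norm a + 1" e]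
      by (simp add: pos_divide_le_eq add_nonneg_pos mult.commute)
    then show ?thesis by (simp add: algebra_simps)
  qed
  finally show "seminorm (cons_tensor a u) \<le> norm a * seminorm u + e" .
qed

lemma seminorm_Cauchy_cons_tensor:
  "seminorm_Cauchy X \<Longrightarrow> seminorm_Cauchy (\<lambda>n. cons_tensor (a :: 'b::complex_banach_algebra_1) (X n))"
  by (erule seminorm_Cauchy_lipschitz[where K = "norm a"])
    (simp add: seminorm_cons_tensor flip: cvec.linear_diff[OF clinear_cons_tensor])

lift_definition cons_top ::
  "'b::complex_banach_algebra_1 \<Rightarrow> 'b tensor completion \<Rightarrow> 'b tensor completion"
  is "\<lambda>a X n. cons_tensor a (X n)"
proof -
  fix a :: 'b and X Y :: "nat \<Rightarrow> 'b tensor"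
  assume *: "completion_rel X Y"
  have "(\<lambda>n. norm a * seminorm (X n - Y n)) \<longlonglongrightarrow> 0"
    using * unfolding completion_rel_def by (auto intro: tendsto_mult_right_zero)
  then have "(\<lambda>n. seminorm (cons_tensor a (X n) - cons_tensor a (Y n))) \<longlonglongrightarrow> 0"
    by (rule seminorm_null_squeeze[rotated])
      (simp add: seminorm_cons_tensor flip: cvec.linear_diff[OF clinear_cons_tensor])
  with * show "completion_rel (\<lambda>n. cons_tensor a (X n)) (\<lambda>n. cons_tensor a (Y n))"
    unfolding completion_rel_def by (auto intro: seminorm_Cauchy_cons_tensor)
qed

lemma cons_top_pure: "cons_top a (to_completion (pure xs)) = to_completion (pure (a # xs))"
  by transfer (simp add: cons_tensor_pure completion_rel_refl)

lemma bounded_bilinear_cons_top: "bounded_bilinear (cons_top :: 'b::complex_banach_algebra_1 \<Rightarrow> _)"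
proof
  fix a b :: 'b and u v :: "'b tensor completion" and r :: real
  obtain X where X: "seminorm_Cauchy X" "u = abs_completion X"
    by (rule abs_completion_cases)
  obtain Y where Y: "seminorm_Cauchy Y" "v = abs_completion Y"
    by (rule abs_completion_cases)
  note simps = X Y cons_top.abs_eq plus_completion.abs_eq scaleC_completion.abs_eq scaleR_completion_def scaleR_scaleC
    completion_rel_refl seminorm_Cauchy_cons_tensor seminorm_Cauchy_add seminorm_Cauchy_scaleC
    cvec.linear_add[OF clinear_cons_tensor] cvec.linear_scale[OF clinear_cons_tensor]
    cvec.linear_add[OF clinear_cons_tensor_left] cvec.linear_scale[OF clinear_cons_tensor_left]
  show "cons_top (a + b) u = cons_top a u + cons_top b u"
    by (simp add: simps)
  show "cons_top a (u + v) = cons_top a u + cons_top a v"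
    by (simp add: simps)
  show "cons_top (r *\<^sub>R a) u = r *\<^sub>R cons_top a u"
    by (simp add: simps)
  show "cons_top a (r *\<^sub>R u) = r *\<^sub>R cons_top a u"
    by (simp add: simps)
next
  show "\<exists>K. \<forall>(a :: 'b) u. norm (cons_top a u) \<le> norm a * norm u * K"
  proof (intro exI[of _ 1] allI)
    fix a :: 'b and u :: "'b tensor completion"
    obtain X where X: "seminorm_Cauchy X" "u = abs_completion X"
      by (rule abs_completion_cases)
    have "cons_top a u = abs_completion (\<lambda>n. cons_tensor a (X n))"
      using X by (simp add: cons_top.abs_eq completion_rel_refl)
    then have "(\<lambda>n. seminorm (cons_tensor a (X n))) \<longlonglongrightarrow> norm (cons_top a u)"
      using norm_abs_completion[OF seminorm_Cauchy_cons_tensor[OF X(1)]] by simp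
    then have "norm (cons_top a u) \<le> norm a * norm u"
      by (rule LIMSEQ_le[OF _ tendsto_mult_left[OF norm_abs_completion[OF X(1), folded X(2)]]])
        (auto intro: seminorm_cons_tensor)
    then show "norm (cons_top a u) \<le> norm a * norm u * 1" by simp
  qed
qed

lemma continuous_on_pure_word:
  assumes "\<And>g. g \<in> set gs \<Longrightarrow> continuous_on S g"
  shows "continuous_on S (\<lambda>s. to_completion (pure (map (\<lambda>g. g s) gs)))"
  using assms
proof (induction gs)
  case (Cons g gs)
  have "continuous_on S (\<lambda>s. cons_top (g s) (to_completion (pure (map (\<lambda>g. g s) gs))))"
    by (rule bounded_bilinear.continuous_on[OF bounded_bilinear_cons_top]) (simp_all add: Cons)
  then show ?case by (simp add: cons_top_pure)
qed simp

section \<open>Integrals of paths of chains\<close>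

text \<open>
  Riemann sums are linear combinations of values, so they stay in the subspace, and they converge to the integral.
\<close>

lemma integral_in_closure_subspace:
  fixes f :: "real \<Rightarrow> 'v::real_normed_vector"
  assumes S: "subspace S" and I: "(f has_integral I) {a..b}" and f: "\<And>s. s \<in> {a..b} \<Longrightarrow> f s \<in> S"
  shows "I \<in> closure S"
  unfolding closure_approachable
proof (intro allI impI)
  fix e :: real assume "e > 0"
  with I[unfolded has_integral_real] obtain \<gamma> where \<gamma>: "gauge \<gamma>"
    "\<forall>\<D>. \<D> tagged_division_of {a..b} \<and> \<gamma> fine \<D> \<longrightarrow> norm ((\<Sum>(x, k)\<in>\<D>. measure lborel k *\<^sub>R f x) - I) < e"
    by meson
  obtain \<D> where \<D>: "\<D> tagged_division_of {a..b}" "\<gamma> fine \<D>"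
    using fine_division_exists_real[OF \<gamma>(1)] .
  have "norm ((\<Sum>(x, k)\<in>\<D>. measure lborel k *\<^sub>R f x) - I) < e"
    using \<gamma>(2) \<D> by simp
  moreover have "(\<Sum>(x, k)\<in>\<D>. measure lborel k *\<^sub>R f x) \<in> S"
  proof (rule subspace_sum[OF S])
    fix z assume "z \<in> \<D>"
    moreover obtain x k where "z = (x, k)"
      by (cases z)
    ultimately show "(case z of (x, k) \<Rightarrow> measure lborel k *\<^sub>R f x) \<in> S"
      using subspace_scale[OF S f[OF tag_in_interval[OF \<D>(1)]]] by simp
  qed
  ultimately show "\<exists>y\<in>S. dist y I < e"
    unfolding dist_norm by (rule bexI)
qed

lemma has_integral_Pair:
  assumes "(f has_integral I) S" "(g has_integral J) S"
  shows "((\<lambda>s. (f s, g s)) has_integral (I, J)) S"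
proof -
  have "((\<lambda>s. (f s, 0) + (0, g s)) has_integral (I, 0) + (0, J)) S"
    using has_integral_linear[OF assms(1), of "\<lambda>x. (x, 0)"] has_integral_linear[OF assms(2), of "\<lambda>x. (0, x)"]
    by (intro has_integral_add) (simp_all add: o_def bounded_linear_Pair bounded_linear_ident bounded_linear_zero)
  then show ?thesis by simp
qed

lemma top_chainsI:
  assumes "\<And>i. X i \<in> hochschild_chains k" "(\<lambda>i. to_completion (X i)) \<longlonglongrightarrow> u"
  shows "u \<in> top_chains k"
  unfolding top_chains_def closure_sequential
  by (intro exI[of _ "\<lambda>i. to_completion (X i)"] conjI allI imageI assms)

text \<open>
  Operators extended by continuity commute with integrals. By \<open>integral_in_closure_subspace\<close>, applied to the
  graph of \<open>f\<close> on chains, there are chains \<open>X i\<close> such that \<open>X i\<close> and \<open>f (X i)\<close> converge simultaneously to the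
  integrals of \<open>F\<close> and \<open>f \<circ> F\<close>, and such a sequence determines the value of the extension.
\<close>

lemma integral_extend:
  fixes f :: "'b::complex_banach_algebra_1 tensor \<Rightarrow> 'b tensor" and F :: "real \<Rightarrow> 'b tensor"
  assumes f: "clinear f" and bound: "\<And>w. w \<in> hochschild_chains k \<Longrightarrow> seminorm (f w) \<le> K * seminorm w"
    and F: "\<And>s. s \<in> {a..b} \<Longrightarrow> F s \<in> hochschild_chains k"
    and cont: "continuous_on {a..b} (\<lambda>s. to_completion (F s))"
  shows "integral {a..b} (\<lambda>s. to_completion (F s)) \<in> top_chains k" (is "?I \<in> _")
    and "continuous_on {a..b} (\<lambda>s. to_completion (f (F s)))"
    and "extend k f (integral {a..b} (\<lambda>s. to_completion (F s))) = integral {a..b} (\<lambda>s. to_completion (f (F s)))"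
proof -
  have lip: "dist (to_completion (f (F s))) (to_completion (f (F s'))) \<le> \<bar>K\<bar> * dist (to_completion (F s)) (to_completion (F s'))"
    if "s \<in> {a..b}" "s' \<in> {a..b}" for s s'
  proof -
    have "dist (to_completion (f (F s))) (to_completion (f (F s'))) = seminorm (f (F s - F s'))"
      by (simp add: dist_norm norm_embed cvec.linear_diff[OF f] flip: cvec.linear_diff[OF clinear_embed])
    also have "\<dots> \<le> K * seminorm (F s - F s')"
      by (rule bound[OF chains_diff[OF F F]]) (use that in auto)
    also have "\<dots> \<le> \<bar>K\<bar> * seminorm (F s - F s')"
      by (intro mult_right_mono seminorm_nonneg) simp
    also have "\<dots> = \<bar>K\<bar> * dist (to_completion (F s)) (to_completion (F s'))"
      by (simp add: dist_norm norm_embed flip: cvec.linear_diff[OF clinear_embed])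
    finally show ?thesis .
  qed
  show cont': "continuous_on {a..b} (\<lambda>s. to_completion (f (F s)))"
    unfolding continuous_on_def
  proof
    fix s assume s: "s \<in> {a..b}"
    have "((\<lambda>s'. \<bar>K\<bar> * dist (to_completion (F s')) (to_completion (F s))) \<longlongrightarrow> \<bar>K\<bar> * dist (to_completion (F s)) (to_completion (F s)))
      (at s within {a..b})"
      using cont s unfolding continuous_on_def by (intro tendsto_intros) auto
    then have "((\<lambda>s'. \<bar>K\<bar> * dist (to_completion (F s')) (to_completion (F s))) \<longlongrightarrow> 0) (at s within {a..b})"
      by simp
    moreover have "\<forall>\<^sub>F s' in at s within {a..b}. dist (to_completion (f (F s'))) (to_completion (f (F s)))
        \<le> \<bar>K\<bar> * dist (to_completion (F s')) (to_completion (F s))"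
      unfolding eventually_at_filter using lip[OF _ s] by (auto intro!: always_eventually)
    ultimately show "((\<lambda>s. to_completion (f (F s))) \<longlongrightarrow> to_completion (f (F s))) (at s within {a..b})"
      by (subst tendsto_dist_iff) (rule tendsto_sandwich[OF _ _ tendsto_const], auto)
  qed
  define G where "G = (\<lambda>w. (to_completion w, to_completion (f w))) ` hochschild_chains k"
  have "subspace G"
    unfolding subspace_def
  proof (intro conjI ballI allI)
    show "0 \<in> G"
      unfolding G_def by (rule image_eqI[OF _ chains_0]) (simp add: cvec.linear_0[OF f] cvec.linear_0[OF clinear_embed] zero_prod_def)
    fix p q :: "'b tensor completion \<times> 'b tensor completion" and r :: real
    assume "p \<in> G"
    then obtain v where v: "v \<in> hochschild_chains k" "p = (to_completion v, to_completion (f v))"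
      unfolding G_def by blast
    show "r *\<^sub>R p \<in> G"
      unfolding G_def by (rule image_eqI[OF _ chains_scaleC[OF v(1), of "complex_of_real r"]])
        (simp add: v(2) scaleR_completion_def cvec.linear_scale[OF f] cvec.linear_scale[OF clinear_embed])
    assume "q \<in> G"
    then obtain w where w: "w \<in> hochschild_chains k" "q = (to_completion w, to_completion (f w))"
      unfolding G_def by blast
    show "p + q \<in> G"
      unfolding G_def by (rule image_eqI[OF _ chains_add[OF v(1) w(1)]])
        (simp add: v(2) w(2) cvec.linear_add[OF f] cvec.linear_add[OF clinear_embed])
  qed
  moreover have "((\<lambda>s. (to_completion (F s), to_completion (f (F s)))) has_integral
      (?I, integral {a..b} (\<lambda>s. to_completion (f (F s))))) {a..b}"
    by (rule has_integral_Pair[OF integrable_continuous_interval[OF cont, THEN integrable_integral]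
          integrable_continuous_interval[OF cont', THEN integrable_integral]])
  ultimately have "(?I, integral {a..b} (\<lambda>s. to_completion (f (F s)))) \<in> closure G"
    by (rule integral_in_closure_subspace) (auto simp: G_def F)
  then obtain Z where Z: "\<And>i. Z i \<in> G" "Z \<longlonglongrightarrow> (?I, integral {a..b} (\<lambda>s. to_completion (f (F s))))"
    unfolding closure_sequential by blast
  have "\<exists>w. w \<in> hochschild_chains k \<and> Z i = (to_completion w, to_completion (f w))" for i
    using Z(1)[of i] unfolding G_def by blast
  then obtain X where X: "\<And>i. X i \<in> hochschild_chains k" "\<And>i. Z i = (to_completion (X i), to_completion (f (X i)))"
    by metis
  have lim: "(\<lambda>i. to_completion (X i)) \<longlonglongrightarrow> ?I"
    "(\<lambda>i. to_completion (f (X i))) \<longlonglongrightarrow> integral {a..b} (\<lambda>s. to_completion (f (F s)))"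
    using tendsto_fst[OF Z(2)] tendsto_snd[OF Z(2)] by (simp_all add: X(2))
  show "?I \<in> top_chains k"
    using X(1) lim(1) by (rule top_chainsI)
  show "extend k f ?I = integral {a..b} (\<lambda>s. to_completion (f (F s)))"
    using extend_tendsto[OF f bound X(1) lim(1)] lim(2) by (rule LIMSEQ_unique)
qed

section \<open>Contraction with a twisted derivation\<close>

lemma clinear_mult_const: "clinear g \<Longrightarrow> clinear (\<lambda>a. g a * (b::'b::complex_algebra_1))"
  by (erule clinear_compose[OF clinear_mult_left])

lemma clinear_const_mult: "clinear g \<Longrightarrow> clinear (\<lambda>a. (b::'b::complex_algebra_1) * g a)"
  by (erule clinear_compose[OF clinear_mult_right])

text \<open>
  When \<open>f\<close> is the identity, this is the contraction of the noncommutative Cartan calculus: the cap product of a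
  Hochschild chain with the one-cocycle \<open>d\<close>.
\<close>

definition contraction_word ::
  "('a::complex_algebra_1 \<Rightarrow> 'b::complex_algebra_1) \<Rightarrow> ('a \<Rightarrow> 'b) \<Rightarrow> 'a list \<Rightarrow> 'b tensor" where
  "contraction_word f d xs = (case xs of x0 # x1 # ys \<Rightarrow> pure ((f x0 * d x1) # map f ys) | _ \<Rightarrow> 0)"

lemma contraction_word_short: "length xs < 2 \<Longrightarrow> contraction_word f d xs = 0"
  by (cases xs; cases "tl xs") (auto simp: contraction_word_def)

lemma length_less_2_cases:
  obtains "length xs < 2" | x0 x1 ys where "xs = x0 # x1 # ys"
  by (cases xs; cases "tl xs") auto

definition contraction ::
  "('a::complex_algebra_1 \<Rightarrow> 'b::complex_algebra_1) \<Rightarrow> ('a \<Rightarrow> 'b) \<Rightarrow> 'a tensor \<Rightarrow> 'b tensor" where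
  "contraction f d = tensor_lift (contraction_word f d)"

text \<open>
  The inner faces of the Hochschild complex, in a form that lets them be peeled off from the front of a word by the
  two rules below; \<open>boundary_word\<close> reaches them by position.
\<close>

definition merge :: "nat \<Rightarrow> 'a::times list \<Rightarrow> 'a list" where
  "merge i xs = take i xs @ (xs ! i * xs ! (i + 1)) # drop (i + 2) xs"

lemma merge_0 [simp]: "merge 0 (x # y # zs) = (x * y) # zs"
  by (simp add: merge_def)

lemma merge_Suc [simp]: "merge (Suc i) (x # xs) = x # merge i xs"
  by (simp add: merge_def)

lemma boundary_pure_Cons:
  assumes "ws \<noteq> []"
  shows "boundary (pure (z # ws)) = (\<Sum>i<length ws. (-1) ^ i *\<^sub>C pure (merge i (z # ws)))
    + (-1) ^ length ws *\<^sub>C pure ((last ws * z) # butlast ws)"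
  using assms by (simp add: boundary_pure boundary_word_def Let_def merge_def last_conv_nth butlast_conv_take nth_Cons')

locale twisted_derivation =
  fixes f d :: "'a::complex_algebra_1 \<Rightarrow> 'b::complex_algebra_1"
  assumes hom: "unital_hom f"
    and clinear_derivation: "clinear d"
    and leibniz: "d (a * b) = d a * f b + f a * d b"
begin

lemma clinear_hom: "clinear f"
  using hom by (simp add: unital_hom_def)

lemma hom_mult: "f (a * b) = f a * f b"
  using hom by (simp add: unital_hom_def)

lemma derivation_one: "d 1 = 0"
  using leibniz[of 1 1] hom by (simp add: unital_hom_def)

lemma map_hom_merge: "Suc i < length xs \<Longrightarrow> map f (merge i xs) = merge i (map f xs)"
  by (simp add: merge_def take_map drop_map hom_mult)

lemma multilinear_contraction_word: "multilinear (contraction_word f d)"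
proof (rule multilinear_context)
  fix xs :: "'a list" and i
  assume i: "i < length xs"
  show "\<exists>g. clinear g \<and> (\<forall>a. contraction_word f d (xs[i := a]) = g a)"
  proof (cases xs rule: length_less_2_cases)
    case 1
    then show ?thesis
      by (intro exI[of _ "\<lambda>a. 0"]) (auto intro: clinearI simp: contraction_word_short)
  next
    case xs: (2 x0 x1 ys)
    consider "i = 0" | "i = 1" | j where "i = Suc (Suc j)"
      by (metis One_nat_def not0_implies_Suc)
    then show ?thesis
    proof cases
      case 1
      then have "contraction_word f d (xs[i := a]) = pure ([] @ (f a * d x1) # map f ys)" for a
        by (simp add: xs contraction_word_def)
      from contextI[OF clinear_pure_mid[OF clinear_mult_const[OF clinear_hom]] this] show ?thesis .
    next
      case 2
      then have "contraction_word f d (xs[i := a]) = pure ([] @ (f x0 * d a) # map f ys)" for a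
        by (simp add: xs contraction_word_def)
      from contextI[OF clinear_pure_mid[OF clinear_const_mult[OF clinear_derivation]] this] show ?thesis .
    next
      case 3
      then have "contraction_word f d (xs[i := a])
          = pure (((f x0 * d x1) # map f (take j ys)) @ f a # map f (drop (Suc j) ys))" for a
        using i by (simp add: xs contraction_word_def upd_conv_take_nth_drop)
      from contextI[OF clinear_pure_mid[OF clinear_hom] this] show ?thesis .
    qed
  qed
qed

lemma clinear_contraction: "clinear (contraction f d)"
  unfolding contraction_def by (rule clinear_tensor_lift[OF multilinear_contraction_word])

lemma contraction_pure: "contraction f d (pure xs) = contraction_word f d xs"
  unfolding contraction_def by (rule tensor_lift_pure[OF multilinear_contraction_word])

lemmas contraction_simps = cvec.linear_0[OF clinear_contraction] cvec.linear_add[OF clinear_contraction]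
  cvec.linear_diff[OF clinear_contraction] cvec.linear_neg[OF clinear_contraction]
  cvec.linear_scale[OF clinear_contraction] cvec.linear_sum[OF clinear_contraction]

lemma contraction_chains:
  assumes "u \<in> hochschild_chains (Suc k)"
  shows "contraction f d u \<in> hochschild_chains k"
  using assms
proof (induction rule: chains_induct)
  case (pure xs)
  then show ?case
    by (auto simp: contraction_pure contraction_word_def length_Suc_conv intro!: pure_in_chains)
qed (auto simp: contraction_simps intro: chains_add chains_scaleC)

text \<open>
  Contraction joins the first two letters, so it lowers the index of every later face by one; this is the sign.
  The exceptions are the first two faces of \<open>x0 \<otimes> x1 \<otimes> x2 \<otimes> \<dots>\<close>, which contract to \<open>x0 x1 dx2\<close> and
  \<open>x0 d(x1 x2)\<close>. By the Leibniz rule their difference is \<open>- x0 dx1 x2\<close>, up to sign the first face of the contraction.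
  In low degree both sides vanish.
\<close>

lemma boundary_contraction: "boundary (contraction f d u) = - contraction f d (boundary u)"
proof (rule clinear_eq_on_pure[OF clinear_compose[OF clinear_boundary clinear_contraction]
      clinear_uminus[OF clinear_compose[OF clinear_contraction clinear_boundary]]])
  fix xs :: "'a list"
  consider "xs = []" | x0 where "xs = [x0]" | x0 x1 where "xs = [x0, x1]"
    | x0 x1 x2 ys where "xs = x0 # x1 # x2 # ys"
    by (metis neq_Nil_conv)
  then show "boundary (contraction f d (pure xs)) = - contraction f d (boundary (pure xs))"
  proof cases
    case (3 x0 x1)
    then show ?thesis
      by (simp add: contraction_pure contraction_word_def boundary_pure_Cons contraction_simps)
        (simp add: boundary_pure boundary_word_def)
  next
    case (4 x0 x1 x2 ys)
    let ?z = "f x0 * d x1"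
    \<comment> \<open>The faces of index at least 2 and the one that joins the last letter to the first. They occur on both
      sides, with opposite signs.\<close>
    let ?S = "\<Sum>i<length ys. (-1) ^ i *\<^sub>C pure (?z # merge i (map f (x2 # ys)))"
    let ?w = "(-1) ^ length ys *\<^sub>C pure ((f (last (x2 # ys)) * ?z) # map f (butlast (x2 # ys)))"
    have c: "contraction f d (pure (a # b # zs)) = pure ((f a * d b) # map f zs)" for a b zs
      by (simp add: contraction_pure contraction_word_def)
    have "boundary (contraction f d (pure xs)) = pure ((?z * f x2) # map f ys) - ?S - ?w"
      by (simp add: 4 c boundary_pure_Cons sum.lessThan_Suc_shift sum_negf cvec.scale_minus_left last_map
          map_butlast scaleC_one del: sum.lessThan_Suc)
    moreover have "contraction f d (boundary (pure xs))
        = pure ((f (x0 * x1) * d x2) # map f ys) - pure ((f x0 * d (x1 * x2)) # map f ys) + ?S + ?w"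
      by (simp add: 4 c boundary_pure_Cons sum.lessThan_Suc_shift sum_negf cvec.scale_minus_left contraction_simps
          hom_mult mult.assoc scaleC_one map_hom_merge del: sum.lessThan_Suc)
    moreover have "pure ((f x0 * d (x1 * x2)) # map f ys)
        = pure ((?z * f x2) # map f ys) + pure ((f (x0 * x1) * d x2) # map f ys)"
      by (simp add: leibniz distrib_left hom_mult mult.assoc pure_Cons_add)
    ultimately show ?thesis by simp
  qed (simp_all add: contraction_pure contraction_word_def boundary_pure boundary_word_def contraction_simps cvec.linear_0[OF clinear_boundary])
qed

text \<open>
  Of the two parts of \<open>B = s N - t s N\<close> only \<open>s N\<close> survives contraction: \<open>t\<close> moves the unit inserted by \<open>s\<close> to the
  second place, where the derivation kills it.
\<close>

lemma contraction_cyc_degen: "contraction f d (cyc (degen u)) = 0"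
proof (rule clinear_eq_on_pure[OF clinear_compose[OF clinear_contraction clinear_compose[OF clinear_cyc clinear_degen]]])
  show "clinear (\<lambda>u. 0)"
    by (rule clinearI) simp_all
  fix xs :: "'a list"
  have "pure (0 # ys) = 0" for ys :: "'b list"
    using pure_Cons_scaleC[of 0 0 ys] by simp
  then show "contraction f d (cyc (degen (pure xs))) = 0"
    by (cases xs) (simp_all add: degen_pure cyc_pure contraction_simps contraction_pure contraction_word_def derivation_one)
qed

text \<open>
  Contracting \<open>1 \<otimes> w\<close> differentiates the first letter of \<open>w\<close>. For a rotation \<open>w\<close> of \<open>xs\<close> the result is the
  same rotation of the word \<open>xs\<close> with one letter differentiated in place. Up to the rotations, contraction after \<open>B\<close> is
  therefore the Lie derivative, the sum over all ways of differentiating one letter.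
\<close>

lemma contraction_connes_pure:
  assumes len: "length xs = Suc n"
  shows "contraction f d (connes n (pure xs))
    = (\<Sum>j\<le>n. (cyc ^^ Suc j) (pure ((map f xs)[n - j := d (xs ! (n - j))])))"
proof -
  \<comment> \<open>With \<open>N = t + \<dots> + t ^ (n + 1)\<close> the summand \<open>t ^ (j + 1)\<close> brings letter \<open>n - j\<close> to the front.\<close>
  have "norm_op n (pure xs) = norm_op n (cyc (pure xs))"
    using norm_op_cyc[OF pure_in_chains[OF len]] by simp
  also have "\<dots> = (\<Sum>j\<le>n. (cyc ^^ Suc j) (pure xs))"
    unfolding norm_op_def funpow_Suc_right comp_def ..
  finally have N: "norm_op n (pure xs) = (\<Sum>j\<le>n. (cyc ^^ Suc j) (pure xs))" .
  have "contraction f d (connes n (pure xs)) = contraction f d (degen (norm_op n (pure xs)))"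
    by (simp add: connes_def contraction_simps contraction_cyc_degen)
  also have "\<dots> = (\<Sum>j\<le>n. contraction f d (degen ((cyc ^^ Suc j) (pure xs))))"
    unfolding N by (simp only: contraction_simps cvec.linear_sum[OF clinear_degen])
  also have "\<dots> = (\<Sum>j\<le>n. (cyc ^^ Suc j) (pure ((map f xs)[n - j := d (xs ! (n - j))])))"
  proof (rule sum.cong[OF refl])
    fix j assume "j \<in> {..n}"
    then have j: "Suc j \<le> Suc n" "Suc n - Suc j = n - j" "n - j < length xs"
      using len by auto
    have "drop (n - j) xs = xs ! (n - j) # drop (Suc (n - j)) xs"
      using j by (simp add: Cons_nth_drop_Suc)
    then have "contraction f d (degen ((cyc ^^ Suc j) (pure xs))) = (-1) ^ (n * Suc j) *\<^sub>C
        pure (d (xs ! (n - j)) # map f (drop (Suc (n - j)) xs @ take (n - j) xs))"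
      unfolding cyc_pow_pure[OF j(1) len] j(2) using hom
      by (simp add: cvec.linear_scale[OF clinear_degen] degen_pure contraction_simps contraction_pure
          contraction_word_def unital_hom_def)
    also have "\<dots> = (cyc ^^ Suc j) (pure ((map f xs)[n - j := d (xs ! (n - j))]))"
      using j len by (subst cyc_pow_pure[OF j(1)]) (simp_all only: j(2) length_list_update length_map,
          simp add: upd_conv_take_nth_drop drop_map take_map)
    finally show "contraction f d (degen ((cyc ^^ Suc j) (pure xs)))
        = (cyc ^^ Suc j) (pure ((map f xs)[n - j := d (xs ! (n - j))]))" .
  qed
  finally show ?thesis .
qed

end

section \<open>Cyclic chains of the completion\<close>

lemma top_chains_sequence:
  assumes "u \<in> top_chains k"
  obtains X where "\<And>i. X i \<in> hochschild_chains k" "(\<lambda>i. to_completion (X i)) \<longlonglongrightarrow> u"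
proof -
  obtain Z where Z: "\<And>i. Z i \<in> to_completion ` hochschild_chains k" "Z \<longlonglongrightarrow> u"
    using assms unfolding top_chains_def closure_sequential by blast
  have "\<exists>w. w \<in> hochschild_chains k \<and> Z i = to_completion w" for i
    using Z(1)[of i] by blast
  then obtain X where "\<And>i. X i \<in> hochschild_chains k" "\<And>i. Z i = to_completion (X i)"
    by metis
  then show thesis
    using that[of X] Z(2) by (metis (no_types, lifting) ext)
qed

lemma embed_top_chains: "u \<in> hochschild_chains k \<Longrightarrow> to_completion u \<in> top_chains k"
  by (rule top_chainsI[of "\<lambda>_. u"]) auto

lemma
  assumes "u \<in> top_chains k" "v \<in> top_chains k"
  shows top_chains_add: "u + v \<in> top_chains k"
    and cyc_top_add: "cyc_top k (u + v) = cyc_top k u + cyc_top k v"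
proof -
  obtain X where X: "\<And>i. X i \<in> hochschild_chains k" "(\<lambda>i. to_completion (X i)) \<longlonglongrightarrow> u"
    using top_chains_sequence[OF assms(1)] by blast
  obtain Y where Y: "\<And>i. Y i \<in> hochschild_chains k" "(\<lambda>i. to_completion (Y i)) \<longlonglongrightarrow> v"
    using top_chains_sequence[OF assms(2)] by blast
  have Z: "\<And>i. X i + Y i \<in> hochschild_chains k" "(\<lambda>i. to_completion (X i + Y i)) \<longlonglongrightarrow> u + v"
    using tendsto_add[OF X(2) Y(2)] by (auto intro: chains_add X Y simp: cvec.linear_add[OF clinear_embed])
  show "u + v \<in> top_chains k"
    using Z by (rule top_chainsI)
  have "(\<lambda>i. to_completion (cyc (X i + Y i))) \<longlonglongrightarrow> cyc_top k u + cyc_top k v"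
    using tendsto_add[OF cyc_top_tendsto[OF X] cyc_top_tendsto[OF Y]]
    by (simp add: cvec.linear_add[OF clinear_embed] cvec.linear_add[OF clinear_cyc])
  then show "cyc_top k (u + v) = cyc_top k u + cyc_top k v"
    using cyc_top_tendsto[OF Z] LIMSEQ_unique by blast
qed

lemma
  assumes "u \<in> top_chains k"
  shows top_chains_scaleC: "c *\<^sub>C u \<in> top_chains k"
    and cyc_top_scaleC: "cyc_top k (c *\<^sub>C u) = c *\<^sub>C cyc_top k u"
    and cyc_top_chains: "cyc_top k u \<in> top_chains k"
proof -
  obtain X where X: "\<And>i. X i \<in> hochschild_chains k" "(\<lambda>i. to_completion (X i)) \<longlonglongrightarrow> u"
    using top_chains_sequence[OF assms(1)] by blast
  note lim = bounded_linear.tendsto[OF bounded_linear_scaleC_completion]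
  have Z: "\<And>i. c *\<^sub>C X i \<in> hochschild_chains k" "(\<lambda>i. to_completion (c *\<^sub>C X i)) \<longlonglongrightarrow> c *\<^sub>C u"
    using lim[OF X(2)] by (auto intro: chains_scaleC X simp: cvec.linear_scale[OF clinear_embed])
  show "c *\<^sub>C u \<in> top_chains k"
    using Z by (rule top_chainsI)
  have "(\<lambda>i. to_completion (cyc (c *\<^sub>C X i))) \<longlonglongrightarrow> c *\<^sub>C cyc_top k u"
    using lim[OF cyc_top_tendsto[OF X]]
    by (simp add: cvec.linear_scale[OF clinear_embed] cvec.linear_scale[OF clinear_cyc])
  then show "cyc_top k (c *\<^sub>C u) = c *\<^sub>C cyc_top k u"
    using cyc_top_tendsto[OF Z] LIMSEQ_unique by blast
  show "cyc_top k u \<in> top_chains k"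
    by (rule top_chainsI[OF cyc_chains[OF X(1)] cyc_top_tendsto[OF X]])
qed

lemma subspace_cyc_image_top: "cvec.subspace (cyc_image_top k :: 'b::complex_banach_algebra_1 tensor completion set)"
proof (rule cvec.subspaceI)
  have "cyc_top k (to_completion 0) = to_completion (cyc (0 :: 'b tensor))"
    by (rule cyc_top_embed[OF chains_0])
  then show "(0 :: 'b tensor completion) \<in> cyc_image_top k"
    unfolding cyc_image_top_def
    by (intro image_eqI[OF _ embed_top_chains[OF chains_0]])
      (simp add: cvec.linear_0[OF clinear_cyc] cvec.linear_0[OF clinear_embed])
next
  fix u v :: "'b tensor completion"
  assume "u \<in> cyc_image_top k" "v \<in> cyc_image_top k"
  then obtain u' v' where "u' \<in> top_chains k" "u = u' - cyc_top k u'" "v' \<in> top_chains k" "v = v' - cyc_top k v'"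
    unfolding cyc_image_top_def by blast
  then show "u + v \<in> cyc_image_top k"
    unfolding cyc_image_top_def
    by (intro image_eqI[of _ _ "u' + v'"]) (simp_all add: top_chains_add cyc_top_add)
next
  fix u :: "'b tensor completion" and c
  assume "u \<in> cyc_image_top k"
  then obtain u' where "u' \<in> top_chains k" "u = u' - cyc_top k u'"
    unfolding cyc_image_top_def by blast
  then show "c *\<^sub>C u \<in> cyc_image_top k"
    unfolding cyc_image_top_def
    by (intro image_eqI[of _ _ "c *\<^sub>C u'"]) (simp_all add: top_chains_scaleC cyc_top_scaleC cvec.scale_right_diff_distrib)
qed

text \<open>
  The cyclic operator acts as the identity on the quotient by the image of \<open>1 - t\<close>, hence so do its powers.
\<close>

lemma cyc_top_pow_cong:
  assumes "u \<in> top_chains k"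
  shows "(cyc_top k ^^ j) u \<in> top_chains k" "u - (cyc_top k ^^ j) u \<in> cyc_image_top k"
proof (induction j)
  case 0
  case 1 show ?case by (simp add: assms)
  case 2 show ?case by (simp add: cvec.subspace_0[OF subspace_cyc_image_top])
next
  case (Suc j)
  case 1 show ?case by (simp add: Suc cyc_top_chains)
  have "(cyc_top k ^^ j) u - cyc_top k ((cyc_top k ^^ j) u) \<in> cyc_image_top k"
    unfolding cyc_image_top_def using Suc(1) by blast
  then have "(u - (cyc_top k ^^ j) u) + ((cyc_top k ^^ j) u - cyc_top k ((cyc_top k ^^ j) u)) \<in> cyc_image_top k"
    by (intro cvec.subspace_add[OF subspace_cyc_image_top] Suc(2))
  then show "u - (cyc_top k ^^ Suc j) u \<in> cyc_image_top k" by simp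
qed

lemma integral_cyc_pow:
  fixes F :: "real \<Rightarrow> 'b::complex_banach_algebra_1 tensor"
  assumes "\<And>s. s \<in> {a..b} \<Longrightarrow> F s \<in> hochschild_chains k"
    and "continuous_on {a..b} (\<lambda>s. to_completion (F s))"
  shows "continuous_on {a..b} (\<lambda>s. to_completion ((cyc ^^ j) (F s)))"
    and "integral {a..b} (\<lambda>s. to_completion ((cyc ^^ j) (F s)))
      = (cyc_top k ^^ j) (integral {a..b} (\<lambda>s. to_completion (F s)))"
proof (induction j)
  case (Suc j)
  have "(cyc ^^ j) (F s) \<in> hochschild_chains k" if "s \<in> {a..b}" for s
    by (induction j) (simp_all add: assms(1)[OF that] cyc_chains)
  note * = integral_extend[OF clinear_cyc cyc_bound this Suc(1)]
  case 1 show ?case using *(2) by simp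
  case 2 show ?case using *(3) Suc(2) by (simp add: cyc_top_def)
qed (simp_all add: assms)

lemma multilinear_push_word:
  assumes "clinear f"
  shows "multilinear (\<lambda>xs. pure (map f xs))"
proof (rule multilinear_context)
  fix xs :: "'a list" and i
  assume "i < length xs"
  then have "pure (map f (xs[i := a])) = pure (map f (take i xs) @ f a # map f (drop (Suc i) xs))" for a
    by (simp add: upd_conv_take_nth_drop)
  from contextI[OF clinear_pure_mid[OF assms] this]
  show "\<exists>g. clinear g \<and> (\<forall>a. pure (map f (xs[i := a])) = g a)" .
qed

lemma clinear_push: "clinear f \<Longrightarrow> clinear (push f)"
  unfolding push_def by (rule clinear_tensor_lift[OF multilinear_push_word])

lemma push_pure: "clinear f \<Longrightarrow> push f (pure xs) = pure (map f xs)"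
  unfolding push_def by (rule tensor_lift_pure[OF multilinear_push_word])

lemma push_chains:
  assumes f: "clinear f" and "u \<in> hochschild_chains k"
  shows "push f u \<in> hochschild_chains k"
  using assms(2)
  by (induction rule: chains_induct)
    (simp_all add: push_pure[OF f] pure_in_chains cvec.linear_add[OF clinear_push[OF f]]
      cvec.linear_scale[OF clinear_push[OF f]] chains_add chains_scaleC)

lemma push_cyc:
  assumes f: "clinear f" and "u \<in> hochschild_chains k"
  shows "push f (cyc u) = cyc (push f u)"
  using assms(2)
proof (induction rule: chains_induct)
  case (pure xs)
  then have "xs \<noteq> []" by auto
  then show ?case
    by (simp add: cyc_pure push_pure[OF f] cvec.linear_scale[OF clinear_push[OF f]] last_map map_butlast)
qed (simp_all add: cvec.linear_add[OF clinear_push[OF f]] cvec.linear_scale[OF clinear_push[OF f]]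
    cvec.linear_add[OF clinear_cyc] cvec.linear_scale[OF clinear_cyc])

lemma coset_eq_iff:
  assumes "cvec.subspace W"
  shows "coset W u = coset W v \<longleftrightarrow> u - v \<in> W"
proof
  assume "coset W u = coset W v"
  moreover have "u + 0 \<in> coset W u"
    unfolding coset_def using cvec.subspace_0[OF assms] by blast
  ultimately show "u - v \<in> W"
    unfolding coset_def by force
next
  have sub: "coset W u \<subseteq> coset W v" if "u - v \<in> W" for u v
  proof
    fix z assume "z \<in> coset W u"
    then obtain w where w: "w \<in> W" "z = u + w"
      unfolding coset_def by blast
    then have "z = v + ((u - v) + w)" by simp
    with w show "z \<in> coset W v"
      unfolding coset_def using cvec.subspace_add[OF assms that] by blast
  qed
  assume "u - v \<in> W"
  moreover from this have "v - u \<in> W"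
    using cvec.subspace_neg[OF assms] by fastforce
  ultimately show "coset W u = coset W v"
    using sub by blast
qed

lemma coset_diff_coset:
  assumes "cvec.subspace W"
  shows "coset_diff (coset W u) (coset W v) = coset W (u - v)"
proof (intro equalityI subsetI)
  fix z assume "z \<in> coset_diff (coset W u) (coset W v)"
  then obtain w w' where w: "w \<in> W" "w' \<in> W" "z = (u + w) - (v + w')"
    unfolding coset_diff_def coset_def by blast
  then have "z = (u - v) + (w - w')" by simp
  with w show "z \<in> coset W (u - v)"
    unfolding coset_def using cvec.subspace_diff[OF assms] by blast
next
  fix z assume "z \<in> coset W (u - v)"
  then obtain w where w: "w \<in> W" "z = (u - v) + w"
    unfolding coset_def by blast
  then have "z = (u + w) - (v + 0)" by simp
  with w show "z \<in> coset_diff (coset W u) (coset W v)"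
    unfolding coset_diff_def coset_def using cvec.subspace_0[OF assms] by blast
qed

lemma push_cyclic_coset:
  fixes f :: "'a::complex_algebra_1 \<Rightarrow> 'b::complex_banach_algebra_1"
  assumes f: "clinear f" and u: "u \<in> hochschild_chains k"
  shows "push_cyclic k f (coset (cyc_image k) u) = coset (cyc_image_top k) (to_completion (push f u))"
proof -
  have "coset (cyc_image_top k) (to_completion (push f v)) = coset (cyc_image_top k) (to_completion (push f u))"
    if v: "v \<in> coset (cyc_image k) u" for v
  proof -
    obtain w where w: "w \<in> hochschild_chains k" "v = u + (w - cyc w)"
      using v unfolding coset_def cyc_image_def by blast
    have "to_completion (push f v) - to_completion (push f u)
        = to_completion (push f w) - cyc_top k (to_completion (push f w))"
      by (simp add: w(2) cyc_top_embed[OF push_chains[OF f w(1)]] push_cyc[OF f w(1)] cvec.linear_add[OF clinear_push[OF f]]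
          cvec.linear_diff[OF clinear_push[OF f]] cvec.linear_add[OF clinear_embed] cvec.linear_diff[OF clinear_embed])
    then have "to_completion (push f v) - to_completion (push f u) \<in> cyc_image_top k"
      unfolding cyc_image_top_def using embed_top_chains[OF push_chains[OF f w(1)]] by blast
    then show ?thesis
      by (simp only: coset_eq_iff[OF subspace_cyc_image_top])
  qed
  moreover have "coset (cyc_image k) u \<noteq> {}"
    unfolding coset_def cyc_image_def using u by blast
  ultimately show ?thesis
    unfolding push_cyclic_def by blast
qed

section \<open>Transgression along a path of homomorphisms\<close>

locale hom_path =
  fixes \<pi> :: "real \<Rightarrow> 'a::complex_algebra_1 \<Rightarrow> 'b::complex_banach_algebra_1"
  assumes unital_hom_path: "t \<in> {0..1} \<Longrightarrow> unital_hom (\<pi> t)"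
    and path_C1: "\<exists>D. continuous_on {0..1} D \<and>
      (\<forall>s\<in>{0..1}. ((\<lambda>t. \<pi> t a) has_vector_derivative D s) (at s within {0..1}))"
begin

definition vel :: "real \<Rightarrow> 'a \<Rightarrow> 'b" where
  "vel s a = vector_derivative (\<lambda>t. \<pi> t a) (at s within {0..1})"

lemma vel_eqI:
  "s \<in> {0..1} \<Longrightarrow> ((\<lambda>t. \<pi> t a) has_vector_derivative D) (at s within {0..1}) \<Longrightarrow> vel s a = D"
  unfolding vel_def using vector_derivative_within_cbox[of 0 1 s "\<lambda>t. \<pi> t a" D] by simp

lemma has_vector_derivative_path:
  "s \<in> {0..1} \<Longrightarrow> ((\<lambda>t. \<pi> t a) has_vector_derivative vel s a) (at s within {0..1})"
  using path_C1[of a] vel_eqI by metis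

lemma continuous_on_vel: "continuous_on {0..1} (\<lambda>s. vel s a)"
proof -
  obtain D where D: "continuous_on {0..1} D"
    "\<forall>s\<in>{0..1}. ((\<lambda>t. \<pi> t a) has_vector_derivative D s) (at s within {0..1})"
    using path_C1 by blast
  then show ?thesis
    using continuous_on_cong[OF refl, of "{0..1}" "\<lambda>s. vel s a" D] vel_eqI by simp
qed

lemma continuous_on_path_eval: "continuous_on {0..1} (\<lambda>s. \<pi> s a)"
  by (rule continuous_on_vector_derivative) (rule has_vector_derivative_path)

lemma clinear_path: "t \<in> {0..1} \<Longrightarrow> clinear (\<pi> t)"
  using unital_hom_path by (simp add: unital_hom_def)

lemma twisted_derivation_vel:
  assumes s: "s \<in> {0..1}"
  shows "twisted_derivation (\<pi> s) (vel s)"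
proof (rule twisted_derivation.intro)
  note transform = has_vector_derivative_transform[OF s]
  show "unital_hom (\<pi> s)"
    by (rule unital_hom_path[OF s])
  show "clinear (vel s)"
  proof (rule clinearI)
    show "vel s (a + b) = vel s a + vel s b" for a b
      by (rule vel_eqI[OF s], rule transform[OF _ has_vector_derivative_add[OF
              has_vector_derivative_path[OF s] has_vector_derivative_path[OF s]]])
        (simp add: cvec.linear_add[OF clinear_path])
    show "vel s (c *\<^sub>C a) = c *\<^sub>C vel s a" for c a
      by (rule vel_eqI[OF s], rule transform[OF _ bounded_linear.has_vector_derivative[OF
              bounded_linear_scaleC_banach has_vector_derivative_path[OF s]]])
        (simp add: cvec.linear_scale[OF clinear_path])
  qed
  show "vel s (a * b) = vel s a * \<pi> s b + \<pi> s a * vel s b" for a b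
    using vel_eqI[OF s transform[OF _ has_vector_derivative_mult[OF
              has_vector_derivative_path[OF s, of a] has_vector_derivative_path[OF s, of b]]], of "a * b"]
      unital_hom_path by (simp add: unital_hom_def add.commute)
qed

text \<open>
  The product rule for tensors: prepending a letter is bounded and bilinear, so it can be differentiated factor by factor.
\<close>

lemma has_vector_derivative_pure:
  assumes s: "s \<in> {0..1}"
  shows "((\<lambda>t. to_completion (pure (map (\<pi> t) xs))) has_vector_derivative
    (\<Sum>i<length xs. to_completion (pure ((map (\<pi> s) xs)[i := vel s (xs ! i)])))) (at s within {0..1})"
proof (induction xs)
  case (Cons x xs)
  interpret cons: bounded_bilinear "cons_top :: 'b \<Rightarrow> _"
    by (rule bounded_bilinear_cons_top)
  show ?case
    using cons.has_vector_derivative[OF has_vector_derivative_path[OF s, of x] Cons]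
    by (simp add: cons_top_pure cons.sum_right sum.lessThan_Suc_shift add.commute del: sum.lessThan_Suc)
qed simp

lemma continuous_on_pure_vel:
  assumes "i < length xs"
  shows "continuous_on {0..1} (\<lambda>s. to_completion (pure ((map (\<pi> s) xs)[i := vel s (xs ! i)])))"
proof -
  have "(map (\<pi> s) xs)[i := vel s (xs ! i)]
      = map (\<lambda>g. g s) ((map (\<lambda>x s. \<pi> s x) xs)[i := \<lambda>s. vel s (xs ! i)])" for s
    by (simp add: map_update comp_def)
  moreover have "continuous_on {0..1} g" if "g \<in> set ((map (\<lambda>x s. \<pi> s x) xs)[i := \<lambda>s. vel s (xs ! i)])" for g
    using subsetD[OF set_update_subset_insert that] continuous_on_path_eval continuous_on_vel by auto
  ultimately show ?thesis
    using continuous_on_pure_word[of "(map (\<lambda>x s. \<pi> s x) xs)[i := \<lambda>s. vel s (xs ! i)]" "{0..1}"] by simp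
qed

abbreviation contr :: "real \<Rightarrow> 'a tensor \<Rightarrow> 'b tensor" where
  "contr s \<equiv> contraction (\<pi> s) (vel s)"

lemma continuous_on_contraction: "continuous_on {0..1} (\<lambda>s. to_completion (contr s u))"
proof (induction u rule: tensor_induct)
  case (1 xs)
  have "continuous_on {0..1} (\<lambda>s. to_completion (contraction_word (\<pi> s) (vel s) xs))"
  proof (cases xs rule: length_less_2_cases)
    case 1
    then show ?thesis by (simp add: contraction_word_short)
  next
    case xs: (2 x0 x1 ys)
    have "continuous_on {0..1} (\<lambda>s. to_completion (pure
        (map (\<lambda>g. g s) ((\<lambda>s. \<pi> s x0 * vel s x1) # map (\<lambda>y s. \<pi> s y) ys))))"
      by (rule continuous_on_pure_word) (auto intro: continuous_on_path_eval continuous_on_vel continuous_on_mult)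
    then show ?thesis
      by (simp add: xs contraction_word_def comp_def)
  qed
  then show ?case
    by (rule continuous_on_cong[THEN iffD1, rotated 2])
      (simp_all add: twisted_derivation.contraction_pure[OF twisted_derivation_vel])
next
  case (2 u v)
  from continuous_on_add[OF this] show ?case
    by (rule continuous_on_cong[THEN iffD1, rotated 2])
      (simp_all add: twisted_derivation.contraction_simps[OF twisted_derivation_vel] cvec.linear_add[OF clinear_embed])
next
  case (3 c u)
  from bounded_linear.continuous_on[OF bounded_linear_scaleC_completion this, of c] show ?case
    by (rule continuous_on_cong[THEN iffD1, rotated 2])
      (simp_all add: twisted_derivation.contraction_simps[OF twisted_derivation_vel] cvec.linear_scale[OF clinear_embed])
qed

lemma integrable_contraction: "(\<lambda>s. to_completion (contr s u)) integrable_on {0..1}"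
  by (rule integrable_continuous_interval) (rule continuous_on_contraction)

lemma clinear_integral_contraction: "clinear (\<lambda>u. integral {0..1} (\<lambda>s. to_completion (contr s u)))"
proof (rule clinearI)
  note simps = twisted_derivation.contraction_simps[OF twisted_derivation_vel]
    cvec.linear_add[OF clinear_embed] cvec.linear_scale[OF clinear_embed]
  fix u v :: "'a tensor" and c
  have "integral {0..1} (\<lambda>s. to_completion (contr s (u + v)))
      = integral {0..1} (\<lambda>s. to_completion (contr s u) + to_completion (contr s v))"
    by (rule integral_cong) (simp add: simps)
  then show "integral {0..1} (\<lambda>s. to_completion (contr s (u + v)))
      = integral {0..1} (\<lambda>s. to_completion (contr s u)) + integral {0..1} (\<lambda>s. to_completion (contr s v))"
    by (simp add: integral_add integrable_contraction)
  have "integral {0..1} (\<lambda>s. to_completion (contr s (c *\<^sub>C u)))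
      = integral {0..1} ((\<lambda>w. c *\<^sub>C w) \<circ> (\<lambda>s. to_completion (contr s u)))"
    by (rule integral_cong) (simp add: simps)
  then show "integral {0..1} (\<lambda>s. to_completion (contr s (c *\<^sub>C u)))
      = c *\<^sub>C integral {0..1} (\<lambda>s. to_completion (contr s u))"
    by (simp only: integral_linear[OF integrable_contraction bounded_linear_scaleC_completion])
qed

text \<open>
  The right-hand side is linear on the whole tensor algebra, so its restriction to words, which is
  \<open>transgression_word\<close>, is multilinear, and the two sides agree.
\<close>

lemma transgression_eq: "transgression \<pi> u = integral {0..1} (\<lambda>s. to_completion (contr s u))"
proof -
  have word: "transgression_word \<pi> xs = integral {0..1} (\<lambda>s. to_completion (contr s (pure xs)))" for xs
  proof -
    have "integral {0..1} (\<lambda>s. to_completion (contr s (pure xs)))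
        = integral {0..1} (\<lambda>s. to_completion (contraction_word (\<pi> s) (vel s) xs))"
      by (rule integral_cong) (simp add: twisted_derivation.contraction_pure[OF twisted_derivation_vel])
    then show ?thesis
      by (auto simp: transgression_word_def contraction_word_def vel_def cvec.linear_0[OF clinear_embed] split: list.split)
  qed
  have word': "transgression_word \<pi> = (\<lambda>xs. integral {0..1} (\<lambda>s. to_completion (contr s (pure xs))))"
    by (rule ext) (rule word)
  have ml: "multilinear (transgression_word \<pi>)"
    by (subst word') (rule multilinear_clinear_pure[OF clinear_integral_contraction])
  have "tensor_lift (transgression_word \<pi>) u = integral {0..1} (\<lambda>s. to_completion (contr s u))"
    by (rule clinear_eq_on_pure[OF clinear_tensor_lift[OF ml] clinear_integral_contraction])
      (simp only: tensor_lift_pure[OF ml] word)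
  then show ?thesis
    by (simp only: transgression_def)
qed

lemma clinear_transgression: "clinear (transgression \<pi>)"
  using clinear_integral_contraction unfolding transgression_eq[abs_def] .

text \<open>
  The boundary passes under the integral, where it anticommutes with the contraction.
\<close>

lemma boundary_transgression:
  assumes u: "u \<in> hochschild_chains (Suc k)"
  shows "boundary_top k (transgression \<pi> u) = - transgression \<pi> (boundary u)"
proof -
  have "contr s u \<in> hochschild_chains k" if "s \<in> {0..1}" for s
    by (rule twisted_derivation.contraction_chains[OF twisted_derivation_vel[OF that] u])
  from integral_extend(3)[OF clinear_boundary boundary_bound this continuous_on_contraction]
  have "boundary_top k (transgression \<pi> u) = integral {0..1} (\<lambda>s. to_completion (boundary (contr s u)))"
    by (simp add: transgression_eq boundary_top_def)
  also have "\<dots> = integral {0..1} (\<lambda>s. - to_completion (contr s (boundary u)))"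
    by (rule integral_cong)
      (simp add: twisted_derivation.boundary_contraction[OF twisted_derivation_vel] cvec.linear_neg[OF clinear_embed])
  finally show ?thesis
    by (simp add: transgression_eq)
qed

text \<open>
  Let \<open>V i\<close> be the integral of the word with letter \<open>i\<close> differentiated. The two end points differ by the sum of all
  \<open>V i\<close>, by the fundamental theorem of calculus and the product rule. By \<open>contraction_connes_pure\<close>, the transgression of
  \<open>B xs\<close> is a sum of powers of \<open>t\<close> applied to the same elements, and these powers act trivially in the quotient.
\<close>

lemma transgression_connes_pure:
  assumes len: "length xs = Suc n"
  shows "(to_completion (push (\<pi> 1) (pure xs)) - to_completion (push (\<pi> 0) (pure xs)))
    - transgression \<pi> (connes n (pure xs)) \<in> cyc_image_top n"
proof -
  define F where "F i s = pure ((map (\<pi> s) xs)[i := vel s (xs ! i)])" for i s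
  let ?V = "\<lambda>i. integral {0..1} (\<lambda>s. to_completion (F i s))"
  have F: "F i s \<in> hochschild_chains n" for i s
    unfolding F_def using len by (simp add: pure_in_chains)
  have cont: "continuous_on {0..1} (\<lambda>s. to_completion (F i s))" if "i \<le> n" for i
    unfolding F_def using that len by (intro continuous_on_pure_vel) simp
  have V: "?V i \<in> top_chains n" if "i \<le> n" for i
    by (rule integral_extend(1)[OF clinear_cyc cyc_bound F cont[OF that]])
  have "((\<lambda>s. \<Sum>i<length xs. to_completion (F i s)) has_integral
      to_completion (pure (map (\<pi> 1) xs)) - to_completion (pure (map (\<pi> 0) xs))) {0..1}"
    unfolding F_def by (rule fundamental_theorem_of_calculus) (auto intro: has_vector_derivative_pure)
  moreover have "((\<lambda>s. \<Sum>i<length xs. to_completion (F i s)) has_integral (\<Sum>i<length xs. ?V i)) {0..1}"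
    using len by (intro has_integral_sum finite_lessThan integrable_integral integrable_continuous_interval cont) simp
  ultimately have "to_completion (pure (map (\<pi> 1) xs)) - to_completion (pure (map (\<pi> 0) xs)) = (\<Sum>i<length xs. ?V i)"
    by (rule has_integral_unique)
  also have "\<dots> = (\<Sum>j\<le>n. ?V (n - j))"
    by (rule sum.reindex_bij_witness[of _ "\<lambda>j. n - j" "\<lambda>i. n - i"]) (use len in auto)
  finally have lie: "to_completion (pure (map (\<pi> 1) xs)) - to_completion (pure (map (\<pi> 0) xs)) = \<dots>" .
  have "transgression \<pi> (connes n (pure xs))
      = integral {0..1} (\<lambda>s. \<Sum>j\<le>n. to_completion ((cyc ^^ Suc j) (F (n - j) s)))"
    unfolding transgression_eq F_def
    by (rule integral_cong)
      (simp add: twisted_derivation.contraction_connes_pure[OF twisted_derivation_vel len]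
        cvec.linear_sum[OF clinear_embed] del: funpow.simps)
  also have "\<dots> = (\<Sum>j\<le>n. integral {0..1} (\<lambda>s. to_completion ((cyc ^^ Suc j) (F (n - j) s))))"
    by (intro integral_sum finite_atMost integrable_continuous_interval integral_cyc_pow(1)[OF F cont]) simp
  also have "\<dots> = (\<Sum>j\<le>n. (cyc_top n ^^ Suc j) (?V (n - j)))"
    by (intro sum.cong refl integral_cyc_pow(2)[OF F cont]) simp
  finally have "(\<Sum>j\<le>n. ?V (n - j)) - transgression \<pi> (connes n (pure xs))
      = (\<Sum>j\<le>n. ?V (n - j) - (cyc_top n ^^ Suc j) (?V (n - j)))"
    by (simp only: sum_subtractf)
  also have "\<dots> \<in> cyc_image_top n"
    by (intro cvec.subspace_sum[OF subspace_cyc_image_top] cyc_top_pow_cong(2) V) simp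
  finally show ?thesis
    by (simp add: push_pure[OF clinear_path] lie)
qed

lemma clinear_connes: "clinear (connes n)"
  unfolding connes_def norm_op_def
  by (rule clinearI)
    (simp_all add: cvec.linear_add[OF clinear_cyc_pow] cvec.linear_scale[OF clinear_cyc_pow] sum.distrib
      cvec.linear_add[OF clinear_degen] cvec.linear_add[OF clinear_cyc] cvec.linear_scale[OF clinear_degen]
      cvec.linear_scale[OF clinear_cyc] cvec.scale_right_diff_distrib flip: cvec.scale_sum_right)

lemma transgression_connes:
  assumes "u \<in> hochschild_chains n"
  shows "(to_completion (push (\<pi> 1) u) - to_completion (push (\<pi> 0) u)) - transgression \<pi> (connes n u) \<in> cyc_image_top n"
proof -
  define h where "h u = (to_completion (push (\<pi> 1) u) - to_completion (push (\<pi> 0) u)) - transgression \<pi> (connes n u)" for u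
  have P: "clinear (push (\<pi> 0))" "clinear (push (\<pi> 1))"
    by (simp_all add: clinear_push clinear_path)
  have h: "clinear h"
    unfolding h_def
    by (rule clinearI)
      (simp_all add: P[THEN cvec.linear_add] P[THEN cvec.linear_scale] cvec.linear_add[OF clinear_embed]
        cvec.linear_scale[OF clinear_embed] cvec.linear_add[OF clinear_transgression] cvec.linear_scale[OF clinear_transgression]
        cvec.linear_add[OF clinear_connes] cvec.linear_scale[OF clinear_connes] cvec.scale_right_diff_distrib)
  from assms have "h u \<in> cyc_image_top n"
  proof (induction rule: chains_induct)
    case (pure xs)
    then show ?case
      unfolding h_def by (rule transgression_connes_pure)
  next
    case (add u v)
    then show ?case
      by (simp add: cvec.linear_add[OF h] cvec.subspace_add[OF subspace_cyc_image_top])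
  next
    case (scaleC c u)
    then show ?case
      by (simp add: cvec.linear_scale[OF h] cvec.subspace_scale[OF subspace_cyc_image_top])
  qed
  then show ?thesis
    by (simp only: h_def)
qed

end

theorem theorem5p1:
  fixes \<pi> :: "real \<Rightarrow> 'a::complex_algebra_1 \<Rightarrow> 'b::complex_banach_algebra_1"
    and n :: nat and x :: "'a tensor set" and y :: "'a tensor"
  assumes "\<And>t. t \<in> {0..1} \<Longrightarrow> unital_hom (\<pi> t)"
    and "\<And>a. \<exists>D. continuous_on {0..1} D \<and>
      (\<forall>s\<in>{0..1}. ((\<lambda>t. \<pi> t a) has_vector_derivative D s) (at s within {0..1}))"
    and "x \<in> cyclic_chains n"
    and "y \<in> hochschild_chains (n + 2)"
    and "boundary y = connes_cyclic n x"
  shows "coset_diff (push_cyclic n (\<pi> 0) x) (push_cyclic n (\<pi> 1) x)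
    = coset (cyc_image_top n) (boundary_top (n + 1) (transgression \<pi> y))"
proof -
  interpret hom_path \<pi>
    using assms(1,2) by unfold_locales
  obtain u where u: "u \<in> hochschild_chains n" "x = coset (cyc_image n) u"
    using assms(3) unfolding cyclic_chains_def by blast
  have by_eq: "boundary y = connes n u"
    using assms(5) u by (simp add: connes_cyclic_coset)
  have "boundary_top (n + 1) (transgression \<pi> y) = - transgression \<pi> (connes n u)"
    using boundary_transgression[of y "n + 1"] assms(4) by (simp add: by_eq)
  moreover have "- ((to_completion (push (\<pi> 1) u) - to_completion (push (\<pi> 0) u)) - transgression \<pi> (connes n u)) \<in> cyc_image_top n"
    by (rule cvec.subspace_neg[OF subspace_cyc_image_top transgression_connes[OF u(1)]])
  ultimately have "(to_completion (push (\<pi> 0) u) - to_completion (push (\<pi> 1) u))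
      - boundary_top (n + 1) (transgression \<pi> y) \<in> cyc_image_top n"
    by (simp add: algebra_simps)
  then show ?thesis
    by (simp add: u(2) push_cyclic_coset[OF clinear_path u(1)] coset_diff_coset[OF subspace_cyc_image_top]
        coset_eq_iff[OF subspace_cyc_image_top])
qed

end
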